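(* Let $f$ be a polynomial of degree $d\ge2$ with a disconnected Julia set, let $\mathcal{K}_f$ be its filled-in Julia set and $\omega_f$ its harmonic measure. If $K$ is a connected component of $\mathcal{K}_f$, then $\omega_f(K)=0$.
   Context: $\mathcal{K}_f=\{z\in\mathbb{C}:\sup_n|f^n(z)|<\infty\}$, and the Julia set is $\partial\mathcal{K}_f$. The harmonic measure $\omega_f$ is the harmonic measure of $\mathcal{K}_f$ with pole at $\infty$, a Borel probability measure on $\mathcal{K}_f$; equivalently, $\omega_f(X)$ is the probability that Brownian motion on the Riemann sphere started at $\infty$ first enters $\mathcal{K}_f$ at a point of $X$. *)

theory Defs
  imports "HOL-Complex_Analysis.Complex_Analysis" "HOL-Probability.Probability"
begin

definition filled_julia :: "complex poly \<Rightarrow> complex set" where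
  "filled_julia f = {z. bounded (range (\<lambda>n. (poly f ^^ n) z))}"

definition julia :: "complex poly \<Rightarrow> complex set" where
  "julia f = frontier (filled_julia f)"

text \<open>
  Continuous subharmonic functions in the sense of Perron's method: the sub-mean value inequality
  holds for every closed disc contained in the open set \<open>U\<close>.
\<close>

definition subharmonic_on :: "(complex \<Rightarrow> real) \<Rightarrow> complex set \<Rightarrow> bool" where
  "subharmonic_on u U \<longleftrightarrow> continuous_on U u \<and>
     (\<forall>a r. 0 < r \<longrightarrow> cball a r \<subseteq> U \<longrightarrow>
        u a \<le> (1 / (2 * pi)) * integral {0..2*pi} (\<lambda>t. u (a + of_real r * cis t)))"

text \<open>
  The Riemann sphere is represented by \<^typ>\<open>complex option\<close>, where \<^const>\<open>None\<close> is the point at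
  infinity. Its two holomorphic charts are \<^const>\<open>Some\<close> and the following one.
\<close>

definition chart_at_inf :: "complex \<Rightarrow> complex option" where
  "chart_at_inf w = (if w = 0 then None else Some (inverse w))"

definition sphere_subharmonic_on :: "(complex option \<Rightarrow> real) \<Rightarrow> complex option set \<Rightarrow> bool" where
  "sphere_subharmonic_on u U \<longleftrightarrow>
     subharmonic_on (u \<circ> Some) (Some -` U) \<and>
     subharmonic_on (u \<circ> chart_at_inf) (chart_at_inf -` U)"

text \<open>
  The Perron family of the boundary function \<open>\<phi>\<close> for the complement of the compact set \<open>K\<close> in the
  Riemann sphere. The point at infinity is an interior point of that open set, so its boundary
  is the frontier of \<open>K\<close> in the plane.
\<close>

definition perron_family :: "complex set \<Rightarrow> (complex \<Rightarrow> real) \<Rightarrow> (complex option \<Rightarrow> real) set" where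
  "perron_family K \<phi> = {u. sphere_subharmonic_on u (- (Some ` K)) \<and>
     (\<forall>\<zeta>\<in>frontier K.
        Limsup (at \<zeta> within - K) (\<lambda>z. ereal (u (Some z))) \<le> ereal (\<phi> \<zeta>))}"

text \<open>
  \<open>\<omega>\<close> is the harmonic measure of the compact set \<open>K\<close> with pole at infinity: the Borel probability
  measure on the boundary whose integrals of continuous functions are the values at infinity of
  the Perron solutions of the Dirichlet problem. These integrals determine \<open>\<omega>\<close>. The supremum is
  taken in \<^typ>\<open>ereal\<close>, so that no default value is involved.
\<close>

definition is_harmonic_measure :: "complex set \<Rightarrow> complex measure \<Rightarrow> bool" where
  "is_harmonic_measure K \<omega> \<longleftrightarrow>
     sets \<omega> = sets borel \<and> prob_space \<omega> \<and> (AE z in \<omega>. z \<in> frontier K) \<and>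
     (\<forall>\<phi>. continuous_on (frontier K) \<phi> \<longrightarrow>
        ereal (LINT z:frontier K|\<omega>. \<phi> z) = (SUP u\<in>perron_family K \<phi>. ereal (u None)))"

end

theory Submission
  imports Defs "HOL-Computational_Algebra.Fundamental_Theorem_Algebra"
begin

text \<open>
  Let \<open>G\<close> be the dynamical Green function \<open>lim d\<^sup>-\<^sup>n ln |f\<^sup>n|\<close>. For \<open>z\<close> outside the filled Julia
  set, truncations of \<open>ln |w - z| - G w\<close> belong to the Perron family of \<open>ln |w - z|\<close>, so the
  logarithmic potential \<open>U\<close> of the harmonic measure is at least minus the Robin constant. The minimum
  principle for \<open>U - G\<close>, together with the mean of \<open>U - G\<close> over large circles, shows that \<open>U\<close> and \<open>G\<close>
  differ by a constant near infinity, whence \<open>U (f z) = d U z + const\<close> there. Thus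
  \<open>d \<integral>h d\<omega> = \<integral>\<Sum>\<^bsub>f x = \<zeta>\<^esub> h x d\<omega>(\<zeta>)\<close> for \<open>h = ln |z - \<cdot>|\<close>, hence for all Cauchy kernels. A Liouville
  argument for Cauchy transforms extends this to indicators of relatively clopen sets, and by a
  limit to indicators of components.

  If \<open>f\<close> maps the component \<open>K\<close> into \<open>K'\<close>, it follows that \<open>\<omega> K \<le> \<omega> K'\<close>, with a loss by the factor
  \<open>(d - 1) / d\<close> unless \<open>K\<close> is the full preimage of \<open>K'\<close>. A component of positive measure
  therefore has an eventually periodic orbit, along whose cycle the measures are constant; so an
  iterate of \<open>f\<close> has a totally invariant component. Every piece of a preimage of a large disc
  meets that component, which makes the filled Julia set connected.
\<close>

section \<open>Means of logarithms over circles\<close>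

text \<open>The harmonic measure is given only through suprema over Perron families: a lower bound
  for an integral needs a single subharmonic function, an upper bound would have to control all of
  them. Hence only a lower bound for \<open>U\<close> is taken from the definition. The reverse
  inequality near infinity comes from normalisation: a nonnegative continuous function with mean 0
  over a circle vanishes on it.

  Invariance of \<omega> under \<open>f\<close> would only show that masses do not decrease along
  the orbit of a component. The loss by \<open>(d - 1) / d\<close> needs the finer fact that the
  points of a fibre, counted with multiplicity, receive equal shares \<open>1 / d\<close>. This is
  first known for logarithmic kernels with poles far away. Instead of approximating all continuous
  functions, the proof uses that Cauchy kernels with poles off the filled Julia set determine the
  mass of every relatively clopen subset, and that such subsets shrink to any component of a compact
  set.\<close>

lemma mean_value_holomorphic:
  fixes F :: "complex \<Rightarrow> complex"
  assumes "F holomorphic_on cball a r" "r > 0"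
  shows "((\<lambda>t. F (a + of_real r * cis t)) has_integral (2 * pi * F a)) {0..2*pi}"
proof -
  have "((\<lambda>u. F u / (u - a)) has_contour_integral (2 * of_real pi * \<i> * F a)) (circlepath a r)"
    using Cauchy_integral_circlepath_simple[OF assms(1), of a] assms(2) by simp
  then have "((\<lambda>t. F (a + of_real r * cis t) / (a + of_real r * cis t - a) * of_real r * \<i> * cis t)
      has_integral (2 * of_real pi * \<i> * F a)) {0..2*pi}"
    unfolding circlepath_def by (subst (asm) has_contour_integral_part_circlepath_iff) auto
  then have "((\<lambda>t. F (a + of_real r * cis t) * \<i>) has_integral (2 * of_real pi * \<i> * F a)) {0..2*pi}"
    by (rule has_integral_eq[rotated]) (use assms(2) in \<open>auto simp: field_simps\<close>)
  then have "((\<lambda>t. F (a + of_real r * cis t) * \<i> * (- \<i>)) has_integral (2 * of_real pi * \<i> * F a * (- \<i>))) {0..2*pi}"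
    by (rule has_integral_mult_left)
  then show ?thesis by (simp add: algebra_simps)
qed

text \<open>For \<open>norm (b / a) < 1\<close> the principal branch
  \<open>Ln (1 + (b / a) * s)\<close> is holomorphic on the closed unit disc and vanishes at 0; the
  claim is the real part of its mean, shifted by \<open>ln (norm a)\<close>.\<close>

lemma mean_ln_affine_less:
  assumes "norm b < norm a"
  shows "((\<lambda>t. ln (norm (a + b * cis t))) has_integral (2 * pi * ln (norm a))) {0..2*pi}"
proof -
  have [simp]: "a \<noteq> 0" using assms by auto
  let ?F = "\<lambda>s. Ln (1 + (b / a) * s)"
  have pos: "1 + (b / a) * s \<notin> \<real>\<^sub>\<le>\<^sub>0" if "norm s \<le> 1" for s
  proof -
    have "norm ((b / a) * s) \<le> norm (b / a) * 1"
      unfolding norm_mult using that by (intro mult_left_mono) auto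
    also have "\<dots> < 1" using assms by (simp add: norm_divide)
    finally have "norm ((b / a) * s) < 1" .
    then have "Re ((b / a) * s) > -1" using abs_Re_le_cmod[of "(b / a) * s"] by linarith
    then show ?thesis by (auto simp: complex_nonpos_Reals_iff)
  qed
  have "?F holomorphic_on cball 0 1"
    using pos by (intro holomorphic_intros) auto
  from mean_value_holomorphic[OF this]
  have "((\<lambda>t. ?F (cis t)) has_integral 0) {0..2*pi}" by simp
  then have "((\<lambda>t. Re (?F (cis t))) has_integral Re 0) {0..2*pi}"
    by (rule has_integral_Re)
  then have "((\<lambda>t. Re (?F (cis t)) + ln (norm a)) has_integral (Re 0 + (2*pi - 0) * ln (norm a))) {0..2*pi}"
    by (intro has_integral_add has_integral_const_real[where a=0 and b="2*pi", simplified]) (use has_integral_const_real[of "ln (norm a)" 0 "2*pi"] in auto)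
  moreover have "Re (?F (cis t)) + ln (norm a) = ln (norm (a + b * cis t))" for t
  proof -
    have nz: "1 + (b / a) * cis t \<noteq> 0" using pos[of "cis t"] by auto
    have "Re (?F (cis t)) + ln (norm a) = ln (norm (1 + (b / a) * cis t) * norm a)"
      using nz by (simp add: ln_mult)
    also have "norm (1 + (b / a) * cis t) * norm a = norm ((1 + (b / a) * cis t) * a)"
      by (simp add: norm_mult)
    also have "(1 + (b / a) * cis t) * a = a + b * cis t" by (simp add: field_simps)
    finally show ?thesis .
  qed
  ultimately show ?thesis by simp
qed

text \<open>Conjugating and multiplying by \<open>cis t\<close> preserves the modulus and exchanges
  the coefficients, which reduces \<open>norm a < norm b\<close> to the holomorphic case.\<close>

lemma norm_affine_cis_swap: "norm (a + b * cis t) = norm (cnj b + cnj a * cis t)"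
proof -
  have "norm (a + b * cis t) = norm (cnj (a + b * cis t) * cis t)"
    by (simp add: norm_mult del: complex_cnj_add)
  also have "cnj (a + b * cis t) * cis t = cnj b + cnj a * cis t"
    by (simp add: algebra_simps flip: cis_cnj) (simp add: cis_cnj cis_mult)
  finally show ?thesis .
qed

lemma mean_ln_affine:
  assumes "norm a \<noteq> norm b"
  shows "((\<lambda>t. ln (norm (a + b * cis t))) has_integral (2 * pi * ln (max (norm a) (norm b)))) {0..2*pi}"
proof (cases "norm b < norm a")
  case True
  then show ?thesis using mean_ln_affine_less[OF True] by (simp add: max_def)
next
  case False
  then have "norm (cnj a) < norm (cnj b)" using assms by simp
  from mean_ln_affine_less[OF this] show ?thesis
    using False by (simp add: norm_affine_cis_swap[of a b] max_def)
qed

text \<open>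
  Scaling \<open>a\<close> by \<open>1 + e\<close> moves the zero of \<open>a + b * cis t\<close> off the unit circle, so that
  \<open>mean_ln_affine\<close> applies; then \<open>e\<close> tends to 0.
\<close>

lemma submean_ln_max_affine_aux:
  fixes q :: "real \<Rightarrow> complex"
  assumes q: "continuous_on {0..2*pi} q" and a: "a \<noteq> 0"
    and nz: "\<And>t. t \<in> {0..2*pi} \<Longrightarrow> max (norm (a + b * cis t)) (norm (q t)) > 0"
  shows "2 * pi * ln (norm a) \<le> integral {0..2*pi} (\<lambda>t. ln (max (norm (a + b * cis t)) (norm (q t))))"
    (is "_ \<le> integral _ ?M")
proof -
  let ?m = "\<lambda>t. max (norm (a + b * cis t)) (norm (q t))"
  have cm: "continuous_on {0..2*pi} ?m" by (intro continuous_intros q)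
  have cM: "continuous_on {0..2*pi} ?M" using nz by (intro continuous_intros cm) fastforce
  have iM: "?M integrable_on {0..2*pi}" by (rule integrable_continuous_real[OF cM])
  obtain t0 where t0: "t0 \<in> {0..2*pi}" "\<And>t. t \<in> {0..2*pi} \<Longrightarrow> ?m t0 \<le> ?m t"
    using continuous_attains_inf[OF compact_Icc _ cm] by auto
  \<comment> \<open>A positive lower bound of the maximum turns the additive error
    \<open>e * norm a\<close> of the perturbation into the factor \<open>1 + e * norm a / c\<close>,
    whose logarithm tends to 0 with \<open>e\<close>.\<close>
  define c where "c = ?m t0"
  have c: "c > 0" "\<And>t. t \<in> {0..2*pi} \<Longrightarrow> c \<le> ?m t" using nz t0 unfolding c_def by auto
  have key: "2 * pi * ln (norm a) \<le> integral {0..2*pi} ?M + 2 * pi * ln (1 + e * norm a / c)"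
    if e: "e > 0" "norm (of_real (1 + e) * a) \<noteq> norm b" for e
  proof -
    let ?a = "of_real (1 + e) * a"
    have hi: "((\<lambda>t. ln (norm (?a + b * cis t))) has_integral (2 * pi * ln (max (norm ?a) (norm b)))) {0..2*pi}"
      by (rule mean_ln_affine[OF e(2)])
    have hi2: "((\<lambda>t. ?M t + ln (1 + e * norm a / c)) has_integral (integral {0..2*pi} ?M + 2 * pi * ln (1 + e * norm a / c))) {0..2*pi}"
      using has_integral_add[OF integrable_integral[OF iM] has_integral_const_real[of "ln (1 + e * norm a / c)" 0 "2*pi"]] by simp
    have na: "norm ?a = (1 + e) * norm a" unfolding norm_mult norm_of_real using e(1) by simp
    have "norm a \<le> norm ?a" unfolding na using e by (simp add: algebra_simps)
    then have "2 * pi * ln (norm a) \<le> 2 * pi * ln (max (norm ?a) (norm b))"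
      using a by (intro mult_left_mono ln_mono) auto
    also have "\<dots> \<le> integral {0..2*pi} ?M + 2 * pi * ln (1 + e * norm a / c)"
    proof (rule has_integral_le[OF hi hi2])
      fix t assume t: "t \<in> {0..2*pi}"
      have "norm (?a + b * cis t) = norm ((a + b * cis t) + of_real e * a)" by (simp add: algebra_simps)
      also have "\<dots> \<le> norm (a + b * cis t) + e * norm a"
        using e(1) by (metis norm_mult norm_of_real abs_of_pos norm_triangle_ineq)
      also have "\<dots> \<le> ?m t + e * norm a" by simp
      also have "\<dots> \<le> ?m t + ?m t * (e * norm a / c)"
      proof -
        have "c * (e * norm a / c) \<le> ?m t * (e * norm a / c)"
          using c(1) e(1) by (intro mult_right_mono c(2)[OF t]) auto
        then show ?thesis using c(1) by simp
      qed
      finally have le: "norm (?a + b * cis t) \<le> ?m t * (1 + e * norm a / c)" by (simp add: algebra_simps)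
      have m1: "?m t > 0" using nz[OF t] .
      have m2: "1 + e * norm a / c > 0" using c(1) e(1) by (intro add_pos_nonneg) auto
      have "1 + e * norm a / c \<ge> 1" using c(1) e(1) by simp
      show "ln (norm (?a + b * cis t)) \<le> ?M t + ln (1 + e * norm a / c)"
      proof (cases "?a + b * cis t = 0")
        case True
        have "norm a \<noteq> 0" using a by simp
        have "norm (?a) = norm (b * cis t)" using True by (metis add_eq_0_iff norm_minus_cancel)
        then have "norm ?a = norm b" by (simp add: norm_mult)
        then show ?thesis using e(2) by simp
      next
        case False
        then have "ln (norm (?a + b * cis t)) \<le> ln (?m t * (1 + e * norm a / c))"
          using le by (intro ln_mono) auto
        also have "\<dots> = ?M t + ln (1 + e * norm a / c)" using m1 m2 by (rule ln_mult_pos)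
        finally show ?thesis .
      qed
    qed
    finally show ?thesis .
  qed
  have ev: "\<forall>\<^sub>F e in at_right 0. 2 * pi * ln (norm a) \<le> integral {0..2*pi} ?M + 2 * pi * ln (1 + e * norm a / c)"
  proof -
    \<comment> \<open>At most one \<open>e\<close> makes the two moduli equal, so all small positive
      \<open>e\<close> avoid it.\<close>
    have "\<forall>\<^sub>F e in at_right (0::real). e > 0 \<and> e \<noteq> norm b / norm a - 1"
    proof (cases "norm b / norm a - 1 > 0")
      case True
      show ?thesis using eventually_at_right_real[OF True] by eventually_elim auto
    next
      case False
      show ?thesis using eventually_at_right_less[of 0] by eventually_elim (use False in auto)
    qed
    then show ?thesis
    proof eventually_elim
      case (elim e)
      show ?case
      proof (rule key)
        show "e > 0" using elim by simp
        have "norm (of_real (1 + e) * a) = (1 + e) * norm a" unfolding norm_mult norm_of_real using elim by simp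
        then show "norm (of_real (1 + e) * a) \<noteq> norm b" using elim a by (auto simp: field_simps)
      qed
    qed
  qed
  have "((\<lambda>e. integral {0..2*pi} ?M + 2 * pi * ln (1 + e * norm a / c)) \<longlongrightarrow> integral {0..2*pi} ?M + 2 * pi * ln (1 + 0 * norm a / c)) (at_right 0)"
    by (intro tendsto_intros) (use c in auto)
  from tendsto_lowerbound[OF this ev] show ?thesis by simp
qed

text \<open>At the centre the maximum is one of the two moduli, and the logarithm of that one alone
  already satisfies the inequality. Two affine functions cover both charts: \<open>w - z\<close>
  against a constant in the plane, \<open>1 - z * w\<close> against a multiple of \<open>w\<close>
  at infinity.\<close>

lemma submean_ln_max_affine:
  assumes nz: "\<And>w. max (norm (p + p' * w)) (norm (q + q' * w)) > 0"
  shows "ln (max (norm (p + p' * x)) (norm (q + q' * x)))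
    \<le> 1 / (2*pi) * integral {0..2*pi} (\<lambda>t. ln (max (norm (p + p' * (x + of_real r * cis t))) (norm (q + q' * (x + of_real r * cis t)))))"
proof -
  have *: "2 * pi * ln (norm (p + p' * x))
    \<le> integral {0..2*pi} (\<lambda>t. ln (max (norm (p + p' * (x + of_real r * cis t))) (norm (q + q' * (x + of_real r * cis t)))))"
    if "p + p' * x \<noteq> 0" and nz: "\<And>w. max (norm (p + p' * w)) (norm (q + q' * w)) > 0" for p p' q q'
  proof -
    have eq: "p + p' * (x + of_real r * cis t) = (p + p' * x) + (p' * of_real r) * cis t" for t
      by (simp add: algebra_simps)
    show ?thesis unfolding eq
    proof (rule submean_ln_max_affine_aux)
      show "continuous_on {0..2*pi} (\<lambda>t. q + q' * (x + of_real r * cis t))" by (intro continuous_intros)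
      show "max (norm (p + p' * x + p' * of_real r * cis t)) (norm (q + q' * (x + of_real r * cis t))) > 0" for t
        using nz[of "x + of_real r * cis t"] unfolding eq .
    qed (use that in auto)
  qed
  have "2 * pi * ln (max (norm (p + p' * x)) (norm (q + q' * x)))
    \<le> integral {0..2*pi} (\<lambda>t. ln (max (norm (p + p' * (x + of_real r * cis t))) (norm (q + q' * (x + of_real r * cis t)))))"
  proof (cases "norm (p + p' * x) \<ge> norm (q + q' * x)")
    case True
    with nz[of x] have "p + p' * x \<noteq> 0" by auto
    from *[OF this nz] show ?thesis using True by (simp add: max_def)
  next
    case False
    with nz[of x] have "q + q' * x \<noteq> 0" by auto
    from *[OF this, of p p'] nz show ?thesis using False by (simp add: max.commute)
  qed
  then show ?thesis by (simp add: field_simps)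
qed

lemma mean_ln_poly:
  fixes p :: "complex poly"
  assumes "r > 0" "\<And>w. w \<in> cball x r \<Longrightarrow> poly p w \<noteq> 0"
  shows "((\<lambda>t. ln (norm (poly p (x + of_real r * cis t)))) has_integral (2 * pi * ln (norm (poly p x)))) {0..2*pi}"
  using assms(2)
proof (induction "degree p" arbitrary: p)
  case 0
  then obtain c where "p = [:c:]" by (metis degree_eq_zeroE)
  then show ?case using has_integral_const_real[of "ln (norm c)" 0 "2*pi"] by simp
next
  case (Suc n)
  then obtain z where z: "poly p z = 0"
    using alg_closed_imp_poly_has_root[of p] by auto
  then obtain g where g: "p = [:- z, 1:] * g" by (metis dvdE poly_eq_0_iff_dvd)
  have "z \<notin> cball x r" using Suc.prems z by blast
  then have zr: "norm (x - z) > r" by (simp add: dist_norm)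
  have gnz: "poly g w \<noteq> 0" if "w \<in> cball x r" for w using Suc.prems[OF that] g by auto
  then have "g \<noteq> 0" using assms(1) by (metis centre_in_cball less_imp_le poly_0)
  then have "degree p = Suc (degree g)" unfolding g by (subst degree_mult_eq) auto
  then have "n = degree g" using Suc.hyps by simp
  from Suc.hyps(1)[OF this] gnz
  have I1: "((\<lambda>t. ln (norm (poly g (x + of_real r * cis t)))) has_integral (2 * pi * ln (norm (poly g x)))) {0..2*pi}"
    by blast
  have I2: "((\<lambda>t. ln (norm ((x - z) + of_real r * cis t))) has_integral (2 * pi * ln (norm (x - z)))) {0..2*pi}"
    by (rule mean_ln_affine_less) (use zr assms(1) in auto)
  have e: "ln (norm (poly p w)) = ln (norm (w - z)) + ln (norm (poly g w))" if "w \<in> cball x r" for w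
  proof -
    have "norm (poly p w) = norm (w - z) * norm (poly g w)" by (simp add: g flip: norm_mult left_diff_distrib)
    moreover have "w \<noteq> z" using that \<open>z \<notin> cball x r\<close> by auto
    ultimately show ?thesis using gnz[OF that] by (simp add: ln_mult)
  qed
  have "((\<lambda>t. ln (norm ((x - z) + of_real r * cis t)) + ln (norm (poly g (x + of_real r * cis t)))) has_integral
     (2 * pi * ln (norm (x - z)) + 2 * pi * ln (norm (poly g x)))) {0..2*pi}"
    by (rule has_integral_add[OF I2 I1])
  then show ?case
  proof (rule has_integral_eq_rhs[OF has_integral_eq, rotated])
    show "2 * pi * ln (norm (poly p x)) = 2 * pi * ln (norm (x - z)) + 2 * pi * ln (norm (poly g x))"
      using e[of x] assms(1) by (simp add: algebra_simps)
    show "ln (norm (x - z + of_real r * cis t)) + ln (norm (poly g (x + of_real r * cis t))) = ln (norm (poly p (x + of_real r * cis t)))"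
      for t using e[of "x + of_real r * cis t"] assms(1) by (simp add: dist_norm norm_mult algebra_simps)
  qed
qed

section \<open>Sums over the roots of a polynomial\<close>

text \<open>The transfer operator of \<open>p\<close>. Since \<open>proots\<close> counts
  multiplicities, the sum has \<open>degree p\<close> terms over every point and stays continuous at
  critical values.\<close>

definition root_sum :: "complex poly \<Rightarrow> (complex \<Rightarrow> 'b::comm_monoid_add) \<Rightarrow> complex \<Rightarrow> 'b" where
  "root_sum p h \<zeta> = (\<Sum>x\<in>#proots (p - [:\<zeta>:]). h x)"

lemma finite_family_convergent_subseq:
  fixes r :: "nat \<Rightarrow> nat \<Rightarrow> 'a::metric_space"
  assumes "compact K" "\<And>k i. i < n \<Longrightarrow> r k i \<in> K"
  shows "\<exists>l \<sigma>. strict_mono (\<sigma>::nat\<Rightarrow>nat) \<and> (\<forall>i<n. l i \<in> K \<and> (\<lambda>k. r (\<sigma> k) i) \<longlonglongrightarrow> l i)"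
  using assms(2)
proof (induction n)
  case 0
  then show ?case by (intro exI[of _ undefined] exI[of _ id]) (auto simp: strict_mono_id)
next
  case (Suc n)
  then obtain l \<sigma> where s: "strict_mono (\<sigma>::nat\<Rightarrow>nat)" "\<And>i. i < n \<Longrightarrow> l i \<in> K \<and> (\<lambda>k. r (\<sigma> k) i) \<longlonglongrightarrow> l i"
    by (metis less_SucI)
  obtain m \<tau> where t: "m \<in> K" "strict_mono (\<tau>::nat\<Rightarrow>nat)" "((\<lambda>k. r (\<sigma> k) n) \<circ> \<tau>) \<longlonglongrightarrow> m"
    using assms(1) Suc.prems unfolding compact_def by (metis lessI)
  show ?case
  proof (intro exI conjI allI impI)
    show "strict_mono (\<sigma> \<circ> \<tau>)" using s t by (simp add: strict_mono_o)
    fix i assume "i < Suc n"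
    then consider "i < n" | "i = n" by linarith
    then have "(l(n := m)) i \<in> K \<and> (\<lambda>k. r ((\<sigma> \<circ> \<tau>) k) i) \<longlonglongrightarrow> (l(n := m)) i"
    proof cases
      case 1
      then show ?thesis using s(2)[OF 1] LIMSEQ_subseq_LIMSEQ[OF conjunct2[OF s(2)[OF 1]] t(2)]
        by (simp add: o_def)
    next
      case 2
      then show ?thesis using t by (simp add: o_def)
    qed
    then show "(l(n := m)) i \<in> K" "(\<lambda>k. r ((\<sigma> \<circ> \<tau>) k) i) \<longlonglongrightarrow> (l(n := m)) i" by auto
  qed
qed

lemma sum_proots_linear_factors:
  fixes n :: nat
  assumes "p = smult a (\<Prod>i<n. [:- l i, 1:])" "(a::complex) \<noteq> 0"
  shows "(\<Sum>x\<in>#proots p. h x) = (\<Sum>i<n. h (l i))"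
proof -
  have "proots p = (\<Sum>i<n. {#l i#})" using assms by (simp add: proots_prod)
  also have "image_mset h \<dots> = (\<Sum>i<n. {#h (l i)#})" by (induction n) auto
  finally have "image_mset h (proots p) = (\<Sum>i<n. {#h (l i)#})" .
  moreover have "sum_mset (\<Sum>i<n. {#h (l i)#}) = (\<Sum>i<n. h (l i))" by (induction n) (auto simp: add.commute)
  ultimately show ?thesis by simp
qed

lemma degree_diff_const: "degree (p - [:c:]) = degree (p :: 'a::ring_1 poly)"
proof (cases "degree p = 0")
  case True
  then obtain b where "p = [:b:]" by (metis degree_eq_zeroE)
  then show ?thesis by simp
next
  case False
  then show ?thesis unfolding diff_conv_add_uminus by (intro degree_add_eq_left) simp
qed

lemma lead_coeff_diff_const: "degree p > 0 \<Longrightarrow> lead_coeff (p - [:c:]) = lead_coeff (p :: 'a::ring_1 poly)"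
  by (simp add: degree_diff_const coeff_eq_0 coeff_pCons split: nat.splits)

lemma poly_root_family:
  fixes p :: "complex poly"
  assumes "degree p > 0"
  obtains r where "p - [:\<zeta>:] = smult (lead_coeff p) (\<Prod>i<degree p. [:- r i, 1:])"
    "\<And>i. i < degree p \<Longrightarrow> poly p (r i) = \<zeta>"
proof -
  obtain r where "smult (lead_coeff (p - [:\<zeta>:])) (\<Prod>i<degree (p - [:\<zeta>:]). [:- r i, 1:]) = p - [:\<zeta>:]"
    by (rule complex_poly_decompose')
  then have r: "p - [:\<zeta>:] = smult (lead_coeff p) (\<Prod>i<degree p. [:- r i, 1:])"
    using lead_coeff_diff_const[OF assms, of \<zeta>] by (simp add: degree_diff_const)
  moreover have "poly p (r i) = \<zeta>" if "i < degree p" for i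
  proof -
    have "poly (p - [:\<zeta>:]) (r i) = 0" unfolding r using that by (auto simp: poly_prod)
    then show ?thesis by simp
  qed
  ultimately show ?thesis by (rule that)
qed

text \<open>The roots need not admit a continuous labelling. Along a subsequence all of them
  converge, the limits factor \<open>p - [:a:]\<close>, and the sum depends only on the multiset of
  roots.\<close>

lemma continuous_on_root_sum:
  fixes h :: "complex \<Rightarrow> 'b::real_normed_vector"
  assumes deg: "degree p > 0" and K: "compact K" and sub: "poly p -` L \<subseteq> K" and h: "continuous_on K h"
  shows "continuous_on L (root_sum p h)"
proof -
  have lc: "lead_coeff p \<noteq> 0" using deg by auto
  have "(root_sum p h \<circ> x) \<longlonglongrightarrow> root_sum p h a" if x: "\<forall>n. x n \<in> L" "a \<in> L" "x \<longlonglongrightarrow> a" for x a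
  proof (rule tendstoI, rule ccontr)
    fix e :: real assume e: "e > 0" and "\<not> (\<forall>\<^sub>F n in sequentially. dist ((root_sum p h \<circ> x) n) (root_sum p h a) < e)"
    from not_eventually_sequentiallyD[OF this(2)] obtain \<rho> where rho: "strict_mono (\<rho>::nat\<Rightarrow>nat)"
      "\<And>n. \<not> dist (root_sum p h (x (\<rho> n))) (root_sum p h a) < e" by auto
    have "\<exists>r. p - [:\<zeta>:] = smult (lead_coeff p) (\<Prod>i<degree p. [:- r i, 1:]) \<and> (\<forall>i<degree p. poly p (r i) = \<zeta>)" for \<zeta>
      using poly_root_family[OF deg] by metis
    then obtain R where R: "\<And>\<zeta>. p - [:\<zeta>:] = smult (lead_coeff p) (\<Prod>i<degree p. [:- R \<zeta> i, 1:])"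
      "\<And>\<zeta> i. i < degree p \<Longrightarrow> poly p (R \<zeta> i) = \<zeta>" by metis
    have RK: "R (x (\<rho> k)) i \<in> K" if "i < degree p" for k i using R(2)[OF that] sub x(1) by auto
    from finite_family_convergent_subseq[OF K, of "degree p" "\<lambda>k. R (x (\<rho> k))"] RK
    obtain l \<sigma> where l: "strict_mono (\<sigma>::nat\<Rightarrow>nat)" "\<And>i. i < degree p \<Longrightarrow> l i \<in> K"
      "\<And>i. i < degree p \<Longrightarrow> (\<lambda>k. R (x (\<rho> (\<sigma> k))) i) \<longlonglongrightarrow> l i" by blast
    have xs: "(\<lambda>k. x (\<rho> (\<sigma> k))) \<longlonglongrightarrow> a"
      using LIMSEQ_subseq_LIMSEQ[OF x(3) strict_mono_o[OF rho(1) l(1)]] by (simp add: o_def)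
    have "p - [:a:] = smult (lead_coeff p) (\<Prod>i<degree p. [:- l i, 1:])"
    proof (rule poly_ext, rule LIMSEQ_unique)
      fix z
      show "(\<lambda>k. poly (p - [:x (\<rho> (\<sigma> k)):]) z) \<longlonglongrightarrow> poly (p - [:a:]) z"
        using xs by (auto intro!: tendsto_intros)
      show "(\<lambda>k. poly (p - [:x (\<rho> (\<sigma> k)):]) z) \<longlonglongrightarrow> poly (smult (lead_coeff p) (\<Prod>i<degree p. [:- l i, 1:])) z"
        unfolding R(1) by (simp add: poly_prod) (intro tendsto_intros l, simp)
    qed
    from sum_proots_linear_factors[OF this lc] have S: "root_sum p h a = (\<Sum>i<degree p. h (l i))"
      by (simp add: root_sum_def)
    have "(\<lambda>k. \<Sum>i<degree p. h (R (x (\<rho> (\<sigma> k))) i)) \<longlonglongrightarrow> (\<Sum>i<degree p. h (l i))"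
    proof (intro tendsto_sum)
      fix i assume "i \<in> {..<degree p}"
      then have i: "i < degree p" by simp
      show "(\<lambda>k. h (R (x (\<rho> (\<sigma> k))) i)) \<longlonglongrightarrow> h (l i)"
        using h[unfolded continuous_on_sequentially, rule_format, of "l i" "\<lambda>k. R (x (\<rho> (\<sigma> k))) i"]
          l(2,3)[OF i] RK[OF i] by (auto simp: o_def)
    qed
    then have "(\<lambda>k. root_sum p h (x (\<rho> (\<sigma> k)))) \<longlonglongrightarrow> root_sum p h a"
      unfolding S by (simp add: root_sum_def sum_proots_linear_factors[OF R(1) lc])
    from tendstoD[OF this e] have "\<forall>\<^sub>F k in sequentially. dist (root_sum p h (x (\<rho> (\<sigma> k)))) (root_sum p h a) < e" .
    then show False using rho(2) by (auto simp: eventually_sequentially)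
  qed
  then show ?thesis unfolding continuous_on_sequentially by blast
qed

lemma continuous_on_extend_0_disjoint:
  assumes "closed E" "closed F" "E \<inter> F = {}" "continuous_on E h"
  shows "continuous_on (E \<union> F) (\<lambda>w. if w \<in> E then h w else 0)"
proof (rule continuous_on_closed_Un[OF assms(1,2)])
  show "continuous_on E (\<lambda>w. if w \<in> E then h w else 0)"
    using assms(4) by (rule continuous_on_eq) auto
  show "continuous_on F (\<lambda>w. if w \<in> E then h w else 0)"
    by (rule continuous_on_eq[of _ "\<lambda>_. 0"]) (use assms(3) in auto)
qed

section \<open>Bounded functionals on continuous functions\<close>

lemma has_field_derivative_quadratic:
  fixes F :: "complex \<Rightarrow> complex"
  assumes "d > 0" "\<And>v. norm v < d \<Longrightarrow> norm (F (z + v) - F z - v * D) \<le> M * (norm v)\<^sup>2"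
  shows "(F has_field_derivative D) (at z)"
proof -
  have "((\<lambda>v. (F (z + v) - F z) / v - D) \<longlongrightarrow> 0) (at 0)"
  proof (rule Lim_null_comparison)
    show "\<forall>\<^sub>F v in at 0. norm ((F (z + v) - F z) / v - D) \<le> M * norm v"
      unfolding eventually_at
    proof (intro exI[of _ d] conjI ballI impI)
      fix v :: complex assume v: "v \<noteq> 0 \<and> dist v 0 < d"
      have "(F (z + v) - F z) / v - D = (F (z + v) - F z - v * D) / v" using v by (simp add: field_simps)
      then have "norm ((F (z + v) - F z) / v - D) \<le> M * (norm v)\<^sup>2 / norm v"
        using assms(2)[of v] v by (simp add: norm_divide divide_right_mono)
      then show "norm ((F (z + v) - F z) / v - D) \<le> M * norm v" using v by (simp add: power2_eq_square)
    qed (rule assms(1))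
    show "((\<lambda>v. M * norm v) \<longlongrightarrow> 0) (at (0::complex))" by (auto intro!: tendsto_eq_intros)
  qed
  then show ?thesis unfolding DERIV_def by (simp add: LIM_zero_iff)
qed

text \<open>Abstracts a difference of two integrals to its linearity and a sup-norm bound. Since the
  bound sees values on \<open>K\<close> only, the case \<open>B = 0\<close> shows that \<Lambda>
  ignores values off \<open>K\<close>.\<close>

locale bounded_C_functional =
  fixes K :: "complex set" and \<Lambda> :: "(complex \<Rightarrow> complex) \<Rightarrow> complex" and c :: real
  assumes K: "compact K"
    and add: "continuous_on K g \<Longrightarrow> continuous_on K h \<Longrightarrow> \<Lambda> (\<lambda>w. g w + h w) = \<Lambda> g + \<Lambda> h"
    and scale: "continuous_on K h \<Longrightarrow> \<Lambda> (\<lambda>w. s * h w) = s * \<Lambda> h"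
    and bound: "continuous_on K h \<Longrightarrow> 0 \<le> B \<Longrightarrow> (\<And>w. w \<in> K \<Longrightarrow> norm (h w) \<le> B) \<Longrightarrow> norm (\<Lambda> h) \<le> c * B"
begin

lemma diff:
  assumes "continuous_on K g" "continuous_on K h"
  shows "\<Lambda> (\<lambda>w. g w - h w) = \<Lambda> g - \<Lambda> h"
proof -
  have "\<Lambda> (\<lambda>w. g w + (-1) * h w) = \<Lambda> g + \<Lambda> (\<lambda>w. (-1) * h w)"
    by (rule add) (intro continuous_intros assms)+
  then show ?thesis using scale[OF assms(2), of "-1"] by simp
qed

context
  fixes E F :: "complex set"
  assumes E: "closed E" and F: "closed F" and EF: "E \<inter> F = {}" "E \<union> F = K"
begin

lemma cont_ext: "continuous_on E h \<Longrightarrow> continuous_on K (\<lambda>w. if w \<in> E then h w else 0)"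
  using continuous_on_extend_0_disjoint[OF E F EF(1)] EF(2) by auto

text \<open>The Cauchy transform of the restriction of \<Lambda> to the relatively clopen part
  \<open>E\<close>; for \<open>z\<close> off \<open>E\<close>, extending the kernel by 0 keeps it
  continuous on \<open>K\<close>.\<close>

definition cauchy_transform :: "complex \<Rightarrow> complex" where
  "cauchy_transform z = \<Lambda> (\<lambda>w. if w \<in> E then 1 / (z - w) else 0)"

lemma cauchy_transform_deriv:
  assumes z: "z \<notin> E"
  shows "\<exists>D. (cauchy_transform has_field_derivative D) (at z)"
proof -
  \<comment> \<open>The ball has radius \<open>2 * d\<close> so that \<open>z + v\<close> keeps
    distance \<open>d\<close> from \<open>E\<close> whenever \<open>norm v < d\<close>.\<close>
  obtain d where d: "d > 0" "ball z (2 * d) \<inter> E = {}"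
  proof -
    obtain e where "e > 0" "ball z e \<subseteq> - E" using E z openE[of "- E" z] by auto
    then show ?thesis by (intro that[of "e / 2"]) auto
  qed
  have far: "norm (z - w) \<ge> 2 * d" if "w \<in> E" for w
    using d that by (auto simp: disjoint_iff dist_norm not_less)
  let ?D = "- \<Lambda> (\<lambda>w. if w \<in> E then 1 / (z - w)\<^sup>2 else 0)"
  have "(cauchy_transform has_field_derivative ?D) (at z)"
  proof (rule has_field_derivative_quadratic[OF d(1)])
    fix v :: complex assume v: "norm v < d"
    have far2: "norm (z + v - w) \<ge> d" if "w \<in> E" for w
    proof -
      have "norm (z - w) \<le> norm (z + v - w) + norm v"
        by (metis add_diff_cancel_right' diff_add_eq norm_triangle_ineq4 add.commute)
      then show ?thesis using far[OF that] v by linarith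
    qed
    have nz: "z - w \<noteq> 0" "z + v - w \<noteq> 0" if "w \<in> E" for w using far[OF that] far2[OF that] d(1) by auto
    have c1: "continuous_on K (\<lambda>w. if w \<in> E then 1 / (z + v - w) else 0)"
      and c2: "continuous_on K (\<lambda>w. if w \<in> E then 1 / (z - w) else 0)"
      and c3: "continuous_on K (\<lambda>w. if w \<in> E then 1 / (z - w)\<^sup>2 else 0)"
      using nz by (intro cont_ext continuous_intros; force)+
    \<comment> \<open>The first-order Taylor remainder of the kernel in \<open>v\<close>; on
      \<open>E\<close> it equals \<open>v\<^sup>2 / ((z - w)\<^sup>2 * (z + v - w))\<close>.\<close>
    let ?g = "\<lambda>w. ((if w \<in> E then 1 / (z + v - w) else 0) - (if w \<in> E then 1 / (z - w) else 0))
        + v * (if w \<in> E then 1 / (z - w)\<^sup>2 else 0)"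
    have "cauchy_transform (z + v) - cauchy_transform z - v * ?D = \<Lambda> ?g"
      unfolding cauchy_transform_def
      by (subst add) (use c1 c2 c3 in \<open>auto intro!: continuous_intros simp: diff scale\<close>)
    also have "norm (\<Lambda> ?g) \<le> c * ((norm v)\<^sup>2 / (4 * d ^ 3))"
    proof (rule bound)
      show "continuous_on K ?g" by (intro continuous_intros c1 c2 c3)
      show "0 \<le> (norm v)\<^sup>2 / (4 * d ^ 3)" using d by simp
      fix w assume "w \<in> K"
      show "norm (?g w) \<le> (norm v)\<^sup>2 / (4 * d ^ 3)"
      proof (cases "w \<in> E")
        case True
        have "?g w = v\<^sup>2 / ((z - w)\<^sup>2 * (z + v - w))"
        proof -
          have "1 / b - 1 / a + v * (1 / a\<^sup>2) = v\<^sup>2 / (a\<^sup>2 * b)" if "a \<noteq> 0" "b \<noteq> 0" "b = a + v" for a b :: complex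
          proof -
            have "1 / b - 1 / a + v * (1 / a\<^sup>2) = (a\<^sup>2 - b * a + v * b) / (a\<^sup>2 * b)"
              using that(1,2) by (simp add: field_simps power2_eq_square)
            also have "a\<^sup>2 - b * a + v * b = v\<^sup>2" unfolding that(3) by (simp add: algebra_simps power2_eq_square)
            finally show ?thesis .
          qed
          from this[OF nz[OF True]] show ?thesis using True by simp
        qed
        then have "norm (?g w) = (norm v)\<^sup>2 / ((norm (z - w))\<^sup>2 * norm (z + v - w))"
          by (simp add: norm_divide norm_mult norm_power)
        also have "\<dots> \<le> (norm v)\<^sup>2 / ((2 * d)\<^sup>2 * d)"
          using far[OF True] far2[OF True] d(1) by (intro divide_left_mono mult_mono power_mono mult_pos_pos) auto
        also have "(2 * d)\<^sup>2 * d = 4 * d ^ 3" by (simp add: power2_eq_square power3_eq_cube)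
        finally show ?thesis .
      qed (use d in auto)
    qed
    finally show "norm (cauchy_transform (z + v) - cauchy_transform z - v * ?D) \<le> c / (4 * d ^ 3) * (norm v)\<^sup>2"
      by (simp add: field_simps)
  qed
  then show ?thesis by blast
qed

lemma cauchy_transform_holomorphic: "cauchy_transform holomorphic_on - E"
  by (metis ComplD cauchy_transform_deriv field_differentiable_at_within field_differentiable_def holomorphic_onI)

text \<open>Since \<open>z / (z - w) - 1 = w / (z - w)\<close> is of order \<open>1 / z\<close>, the
  leading coefficient at infinity is the value of \<Lambda> at the indicator of \<open>E\<close>.
  The first estimate supplies the decay for Liouville's theorem.\<close>

lemma cauchy_transform_bound:
  assumes R: "\<And>w. w \<in> K \<Longrightarrow> norm w \<le> R" and z: "norm z > R" and R0: "R \<ge> 0"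
  shows "norm (cauchy_transform z) \<le> c / (norm z - R)"
    and "norm (z * cauchy_transform z - \<Lambda> (\<lambda>w. if w \<in> E then 1 else 0)) \<le> c * R / (norm z - R)"
proof -
  have far: "norm (z - w) \<ge> norm z - R" if "w \<in> K" for w
    using norm_triangle_ineq2[of z w] R[OF that] by linarith
  then have nz: "z - w \<noteq> 0" if "w \<in> E" for w
    using that EF z by (metis UnI1 diff_gt_0_iff_gt linorder_not_less norm_zero)
  have c1: "continuous_on K (\<lambda>w. if w \<in> E then 1 / (z - w) else 0)"
    and c2: "continuous_on K (\<lambda>w. if w \<in> E then 1 else (0::complex))"
    using nz by (intro cont_ext continuous_intros; force)+
  have "norm (cauchy_transform z) \<le> c * (1 / (norm z - R))"
    unfolding cauchy_transform_def
  proof (rule bound[OF c1])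
    show "norm (if w \<in> E then 1 / (z - w) else 0) \<le> 1 / (norm z - R)" if "w \<in> K" for w
      using far[OF that] z by (auto simp: norm_divide intro!: divide_left_mono mult_pos_pos)
  qed (use z in auto)
  then show "norm (cauchy_transform z) \<le> c / (norm z - R)" by simp
  let ?g = "\<lambda>w. z * (if w \<in> E then 1 / (z - w) else 0) - (if w \<in> E then 1 else 0)"
  have "z * cauchy_transform z - \<Lambda> (\<lambda>w. if w \<in> E then 1 else 0) = \<Lambda> ?g"
    unfolding cauchy_transform_def by (subst diff) (use c1 c2 in \<open>auto intro!: continuous_intros simp: scale\<close>)
  also have "norm (\<Lambda> ?g) \<le> c * (R / (norm z - R))"
  proof (rule bound)
    show "continuous_on K ?g" by (intro continuous_intros c1 c2)
    show "norm (?g w) \<le> R / (norm z - R)" if w: "w \<in> K" for w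
    proof (cases "w \<in> E")
      case True
      have "?g w = w / (z - w)" using nz[OF True] True by (simp add: field_simps)
      then have "norm (?g w) = norm w / norm (z - w)" by (simp only: norm_divide)
      also have "\<dots> \<le> R / (norm z - R)" using R[OF w] R0 far[OF w] z by (intro frac_le) auto
      finally show ?thesis .
    qed (use z R0 in auto)
  qed (use z R0 in auto)
  finally show "norm (z * cauchy_transform z - \<Lambda> (\<lambda>w. if w \<in> E then 1 else 0)) \<le> c * R / (norm z - R)"
    by simp
qed

end

text \<open>
  The Cauchy transforms of the restrictions to \<open>E\<close> and \<open>F\<close> add up to 0 off \<open>K\<close>, so they glue to an
  entire function that vanishes at infinity. The value at the indicator of \<open>E\<close> is the coefficient
  of \<open>1 / z\<close> of one of them.
\<close>

lemma indicator_functional_eq_0: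
  assumes E: "closed E" and F: "closed F" and EF: "E \<inter> F = {}" "E \<union> F = K"
    and zero: "\<And>z. z \<notin> K \<Longrightarrow> \<Lambda> (\<lambda>w. 1 / (z - w)) = 0"
  shows "\<Lambda> (\<lambda>w. if w \<in> E then 1 else 0) = 0"
proof -
  have FE: "F \<inter> E = {}" "F \<union> E = K" using EF by auto
  let ?CE = "cauchy_transform E" and ?CF = "cauchy_transform F"
  have defE: "?CE z = \<Lambda> (\<lambda>w. if w \<in> E then 1 / (z - w) else 0)" for z
    by (rule cauchy_transform_def[OF E F EF])
  have defF: "?CF z = \<Lambda> (\<lambda>w. if w \<in> F then 1 / (z - w) else 0)" for z
    by (rule cauchy_transform_def[OF F E FE])
  have cong: "\<Lambda> g = \<Lambda> h" if "continuous_on K g" "continuous_on K h" "\<And>w. w \<in> K \<Longrightarrow> g w = h w" for g h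
    using bound[of "\<lambda>w. g w - h w" 0] that by (simp add: diff continuous_on_diff)
  have sum0: "?CE z = - ?CF z" if "z \<notin> K" for z
  proof -
    have nz: "z - w \<noteq> 0" if "w \<in> K" for w using that \<open>z \<notin> K\<close> by auto
    have c1: "continuous_on K (\<lambda>w. if w \<in> E then 1 / (z - w) else 0)"
      using nz EF by (intro cont_ext[OF E F EF] continuous_intros) auto
    have c2: "continuous_on K (\<lambda>w. if w \<in> F then 1 / (z - w) else 0)"
      using nz EF by (intro cont_ext[OF F E FE] continuous_intros) auto
    have "?CE z + ?CF z = \<Lambda> (\<lambda>w. (if w \<in> E then 1 / (z - w) else 0) + (if w \<in> F then 1 / (z - w) else 0))"
      unfolding defE defF by (rule add[OF c1 c2, symmetric])
    also have "\<dots> = \<Lambda> (\<lambda>w. 1 / (z - w))"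
    proof (rule cong)
      show "continuous_on K (\<lambda>w. 1 / (z - w))" using nz by (intro continuous_intros) auto
      show "continuous_on K (\<lambda>w. (if w \<in> E then 1 / (z - w) else 0) + (if w \<in> F then 1 / (z - w) else 0))"
        by (intro continuous_on_add c1 c2)
    qed (use EF in auto)
    finally show ?thesis using zero[OF that] by (simp add: eq_neg_iff_add_eq_0)
  qed
  \<comment> \<open>On \<open>E\<close>, where the first transform may be singular, the negative of
    the second one continues it; off \<open>K\<close> the two agree.\<close>
  define e where "e z = (if z \<in> E then - ?CF z else ?CE z)" for z
  have "e holomorphic_on (- E \<union> - F)"
  proof (rule holomorphic_on_Un)
    show "e holomorphic_on - E"
      by (rule holomorphic_transform[OF cauchy_transform_holomorphic[OF E F EF]]) (auto simp: e_def)
    show "e holomorphic_on - F"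
      by (rule holomorphic_transform[OF holomorphic_on_minus[OF cauchy_transform_holomorphic[OF F E FE]]])
        (use sum0 EF in \<open>auto simp: e_def\<close>)
  qed (use E F in auto)
  moreover have "- E \<union> - F = UNIV" using EF by auto
  ultimately have hol: "e holomorphic_on UNIV" by simp
  obtain R where R: "R \<ge> 0" "\<And>w. w \<in> K \<Longrightarrow> norm w \<le> R"
    using compact_imp_bounded[OF K] unfolding bounded_pos by (meson less_imp_le)
  have eE: "e z = ?CE z" if "norm z > R" for z using that R EF by (force simp: e_def)
  have "(e \<longlongrightarrow> 0) at_infinity"
  proof (rule Lim_null_comparison)
    show "\<forall>\<^sub>F z in at_infinity. norm (e z) \<le> c / (norm z - R)"
      unfolding eventually_at_infinity
      by (rule exI[of _ "R + 1"]) (use cauchy_transform_bound(1)[OF E F EF R(2) _ R(1)] eE in auto)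
    show "((\<lambda>z. c / (norm z - R)) \<longlongrightarrow> 0) (at_infinity :: complex filter)"
      by (intro tendsto_divide_0[OF tendsto_const] filterlim_at_top_imp_at_infinity)
        (auto intro!: filterlim_tendsto_add_at_top[OF tendsto_const filterlim_norm_at_top, of "-R", simplified])
  qed
  from Liouville_weak_0[OF hol this] have e0: "e z = 0" for z .
  let ?m = "\<Lambda> (\<lambda>w. if w \<in> E then 1 else 0)"
  \<comment> \<open>Along the positive real axis the vanishing of \<open>e\<close> turns the second
    estimate into a bound for \<open>norm ?m\<close> alone.\<close>
  have "((\<lambda>t. c * R / (t - R)) \<longlongrightarrow> 0) at_top" by real_asymp
  moreover have "\<forall>\<^sub>F t in at_top. norm ?m \<le> c * R / (t - R)"
    using eventually_gt_at_top[of R]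
  proof eventually_elim
    case (elim t)
    then have t: "norm (of_real t :: complex) = t" "t > R" using R(1) by auto
    show ?case using cauchy_transform_bound(2)[OF E F EF R(2) _ R(1), of "of_real t"] t
      by (simp add: e0 eE[of "of_real t", symmetric])
  qed
  ultimately have "norm ?m \<le> 0" by (rule tendsto_lowerbound) simp
  then show ?thesis by simp
qed

text \<open>
  The Cauchy kernel is the complex gradient of \<open>ln |z - w|\<close>, which transfers vanishing on an open
  set; analytic continuation does the rest.
\<close>

lemma kernel_functional_eq_0:
  assumes conn: "connected (- K)" and V: "open V" "V \<noteq> {}" "V \<subseteq> - K"
    and real: "\<And>h. continuous_on K h \<Longrightarrow> \<Lambda> (\<lambda>w. of_real (Re (h w))) = of_real (Re (\<Lambda> h))"
    and zero: "\<And>z. z \<in> V \<Longrightarrow> \<Lambda> (\<lambda>w. of_real (ln (norm (z - w)))) = 0"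
    and z: "z \<notin> K"
  shows "\<Lambda> (\<lambda>w. 1 / (z - w)) = 0"
proof -
  have cK: "closed K" by (rule compact_imp_closed[OF K])
  have cong: "\<Lambda> g = \<Lambda> h" if "continuous_on K g" "continuous_on K h" "\<And>w. w \<in> K \<Longrightarrow> g w = h w" for g h
    using bound[of "\<lambda>w. g w - h w" 0] that by (simp add: diff continuous_on_diff)
  let ?C = "cauchy_transform K"
  have C: "?C z = \<Lambda> (\<lambda>w. 1 / (z - w))" if "z \<notin> K" for z
    unfolding cauchy_transform_def[OF cK closed_empty Int_empty_right Un_empty_right]
  proof (rule cong)
    show c: "continuous_on K (\<lambda>w. 1 / (z - w))" using that by (intro continuous_intros) auto
    show "continuous_on K (\<lambda>w. if w \<in> K then 1 / (z - w) else 0)"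
      using c by (rule continuous_on_eq) auto
  qed auto
  have "?C z = 0" if zV: "z \<in> V" for z
  proof (rule ccontr)
    assume nz: "?C z \<noteq> 0"
    have zK: "z \<notin> K" using zV V by auto
    obtain d where d: "d > 0" "ball z (2 * d) \<subseteq> V"
    proof -
      obtain e where "e > 0" "ball z e \<subseteq> V" using V zV openE by blast
      then show ?thesis by (intro that[of "e / 2"]) auto
    qed
    have far: "norm (z - w) \<ge> 2 * d" if "w \<in> K" for w
      using d that V by (auto simp: subset_iff dist_norm)
    \<comment> \<open>With \<open>s = v / (z - w)\<close>, the increment of the logarithmic kernel
      is \<open>Re (Ln (1 + s))\<close>, hence \<open>Re s\<close> up to order
      \<open>(norm s)\<^sup>2\<close>. \<Lambda> kills both logarithms, so only the real part of
      \<open>v * ?C z\<close> is left to be of second order.\<close>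
    have key: "\<bar>Re (v * ?C z)\<bar> \<le> c * (norm v)\<^sup>2 / (2 * d\<^sup>2)" if v: "norm v < d" for v
    proof -
      have zv: "z + v \<in> V" "z + v \<notin> K"
        using d v V by (auto simp: subset_iff dist_norm norm_minus_commute)
      have nzw: "z - w \<noteq> 0" "z + v - w \<noteq> 0" if "w \<in> K" for w using that zK zv by auto
      let ?h1 = "\<lambda>w. complex_of_real (ln (norm (z + v - w)))"
      let ?h2 = "\<lambda>w. complex_of_real (ln (norm (z - w)))"
      let ?h3 = "\<lambda>w. complex_of_real (Re (v * (1 / (z - w))))"
      have c1: "continuous_on K ?h1" and c2: "continuous_on K ?h2" and c3: "continuous_on K ?h3"
        and c4: "continuous_on K (\<lambda>w. 1 / (z - w))"
        using nzw by (intro continuous_intros; force)+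
      have "\<Lambda> ?h3 = of_real (Re (v * \<Lambda> (\<lambda>w. 1 / (z - w))))"
        using real[OF continuous_on_mult_left[OF c4, of v]] scale[OF c4, of v] by simp
      then have "\<Lambda> ?h3 = of_real (Re (v * ?C z))" using C[OF zK] by simp
      moreover have "\<Lambda> (\<lambda>w. ?h1 w - ?h2 w - ?h3 w) = \<Lambda> ?h1 - \<Lambda> ?h2 - \<Lambda> ?h3"
        using diff[OF continuous_on_diff[OF c1 c2] c3] diff[OF c1 c2] by simp
      ultimately have eq: "norm (\<Lambda> (\<lambda>w. ?h1 w - ?h2 w - ?h3 w)) = \<bar>Re (v * ?C z)\<bar>"
        using zero[OF zV] zero[OF zv(1)] by (simp only: diff_0 diff_zero norm_minus_cancel norm_of_real)
      have "norm (\<Lambda> (\<lambda>w. ?h1 w - ?h2 w - ?h3 w)) \<le> c * ((norm v)\<^sup>2 / (2 * d\<^sup>2))"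
      proof (rule bound)
        show "continuous_on K (\<lambda>w. ?h1 w - ?h2 w - ?h3 w)" by (intro continuous_on_diff c1 c2 c3)
        fix w assume w: "w \<in> K"
        define s where "s = v / (z - w)"
        have ns: "norm s \<le> norm v / (2 * d)"
          unfolding s_def norm_divide using far[OF w] d by (intro divide_left_mono mult_pos_pos) auto
        also have "\<dots> < 1 / 2" using v d by (simp add: field_simps)
        finally have s2: "norm s < 1 / 2" .
        have s1: "1 + s \<noteq> 0"
        proof
          assume "1 + s = 0"
          then have "s = -1" by (simp add: add_eq_0_iff)
          then show False using s2 by simp
        qed
        have "z + v - w = (z - w) * (1 + s)" using nzw[OF w] by (simp add: s_def field_simps)
        then have "ln (norm (z + v - w)) = ln (norm (z - w)) + ln (norm (1 + s))"
          using nzw[OF w] s1 by (simp add: norm_mult ln_mult)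
        then have "?h1 w - ?h2 w - ?h3 w = of_real (Re (Ln (1 + s) - s))"
          using s1 by (simp add: s_def)
        then have "norm (?h1 w - ?h2 w - ?h3 w) \<le> norm (Ln (1 + s) - s)"
          by (metis abs_Re_le_cmod norm_of_real)
        also have "\<dots> \<le> (norm s)\<^sup>2 / (1 - norm s)" by (rule Ln_approx_linear) (use s2 in simp)
        also have "\<dots> \<le> (norm s)\<^sup>2 / (1 / 2)" using s2 by (intro divide_left_mono) auto
        also have "\<dots> \<le> (norm v / (2 * d))\<^sup>2 / (1 / 2)" using ns by (intro divide_right_mono power_mono) auto
        also have "\<dots> = (norm v)\<^sup>2 / (2 * d\<^sup>2)" by (simp add: power2_eq_square)
        finally show "norm (?h1 w - ?h2 w - ?h3 w) \<le> (norm v)\<^sup>2 / (2 * d\<^sup>2)" .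
      qed auto
      then show ?thesis unfolding eq by simp
    qed
    let ?a = "norm (?C z)"
    have apos: "?a > 0" using nz by simp
    have "((\<lambda>t. c * t / (2 * d\<^sup>2)) \<longlongrightarrow> c * 0 / (2 * d\<^sup>2)) (at_right 0)"
      using d by (intro tendsto_intros) auto
    moreover have "\<forall>\<^sub>F t in at_right (0::real). 1 \<le> c * t / (2 * d\<^sup>2)"
    proof (rule eventually_mono)
      show "\<forall>\<^sub>F t in at_right (0::real). t \<in> {0<..<d / ?a}"
        by (rule eventually_at_right_real) (use apos d(1) in simp)
      fix t :: real assume "t \<in> {0<..<d / ?a}"
      then have t: "t > 0" "t * ?a < d" using apos by (auto simp: field_simps)
      \<comment> \<open>In this direction \<open>?v * ?C z\<close> equals
        \<open>t * ?a\<^sup>2\<close>, linear in \<open>t\<close>, whereas the bound is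
        quadratic.\<close>
      let ?v = "of_real t * cnj (?C z)"
      have nv: "norm ?v = t * ?a" using t by (simp add: norm_mult)
      have "?v * ?C z = of_real (t * ?a\<^sup>2)" using complex_norm_square[of "?C z"] by (simp add: ac_simps)
      then have "t * ?a\<^sup>2 = \<bar>Re (?v * ?C z)\<bar>" using t by (simp only: Re_complex_of_real) simp
      also have "\<dots> \<le> c * (t * ?a)\<^sup>2 / (2 * d\<^sup>2)" using key[of ?v] t nv by simp
      also have "\<dots> = (c * t / (2 * d\<^sup>2)) * (t * ?a\<^sup>2)" by (simp add: power2_eq_square)
      finally have "1 * (t * ?a\<^sup>2) \<le> (c * t / (2 * d\<^sup>2)) * (t * ?a\<^sup>2)" by simp
      moreover have "t * ?a\<^sup>2 > 0" using t apos by simp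
      ultimately show "1 \<le> c * t / (2 * d\<^sup>2)" by (simp only: mult_le_cancel_right_pos)
    qed
    ultimately have "1 \<le> c * 0 / (2 * d\<^sup>2)" by (rule tendsto_lowerbound) simp
    then show False by simp
  qed
  note CV = this
  obtain x where "x \<in> V" using V by blast
  have "?C z = 0"
  proof (rule analytic_continuation[of ?C "- K" V x])
    show "?C holomorphic_on - K" by (rule cauchy_transform_holomorphic[OF cK closed_empty]) auto
    show "x islimpt V" using V \<open>x \<in> V\<close> by (simp add: interior_limit_point interior_open)
  qed (use cK conn V z \<open>x \<in> V\<close> CV in auto)
  then show ?thesis using C[OF z] by simp
qed

end

section \<open>Iteration and the filled Julia set\<close>

text \<open>\<open>p\<close> is an open map, so a relatively open subset of the full preimage has an
  image open in \<open>C\<close>; compactness makes the image closed, and \<open>C\<close> is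
  connected.\<close>

lemma poly_clopen_surj:
  fixes p :: "complex poly"
  assumes deg: "degree p > 0" and C: "connected C"
    and E: "openin (top_of_set (poly p -` C)) E" "compact E" "E \<noteq> {}"
  shows "poly p ` E = C"
proof -
  obtain U where U: "open U" "E = poly p -` C \<inter> U" using E(1) by (auto simp: openin_open)
  have eq: "poly p ` E = C \<inter> poly p ` U" unfolding U(2) by auto
  have "open (poly p ` U)"
  proof (rule open_mapping_thm[of "poly p" UNIV U])
    show "\<not> poly p constant_on UNIV"
    proof
      assume "poly p constant_on UNIV"
      then have "constant (poly p)" unfolding constant_on_def constant_def by auto
      then show False using deg by (simp add: constant_degree)
    qed
  qed (use U in \<open>auto intro!: holomorphic_intros\<close>)
  then have "openin (top_of_set C) (poly p ` E)" unfolding eq by (rule openin_open_Int)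
  moreover have "closedin (top_of_set C) (poly p ` E)"
  proof (rule closed_subset)
    show "closed (poly p ` E)"
      by (rule compact_imp_closed[OF compact_continuous_image[OF _ E(2)]]) (intro continuous_intros)
  qed (use eq in auto)
  ultimately show ?thesis using C E(3) unfolding connected_clopen by (metis image_is_empty)
qed

text \<open>A component need not be relatively open. If it missed the fibre over some point, so
  would a relatively clopen neighbourhood of it, against the surjectivity of such pieces.\<close>

lemma poly_component_surj:
  fixes p :: "complex poly"
  assumes deg: "degree p > 0" and C: "connected C" and cpt: "compact (poly p -` C)"
    and A: "A \<in> components (poly p -` C)"
  shows "poly p ` A = C"
proof -
  have AS: "A \<subseteq> poly p -` C" "A \<noteq> {}" using A in_components_subset in_components_nonempty by auto
  have "\<zeta> \<in> poly p ` A" if z: "\<zeta> \<in> C" for \<zeta>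
  proof (rule ccontr)
    assume n: "\<zeta> \<notin> poly p ` A"
    have op: "open (- (poly p -` {\<zeta>}))"
      by (intro open_Compl closed_vimage continuous_intros closed_singleton)
    have cA: "compact A" by (rule compact_components[OF cpt A])
    obtain E where E: "openin (top_of_set (poly p -` C)) E" "compact E" "A \<subseteq> E" "E \<subseteq> - (poly p -` {\<zeta>})"
      by (rule Sura_Bura_clopen_subset[OF closed_imp_locally_compact[OF compact_imp_closed[OF cpt]] A cA op])
        (use n in auto)
    have "poly p ` E = C" using AS E(3) by (intro poly_clopen_surj[OF deg C E(1,2)]) auto
    then show False using z E(4) by auto
  qed
  then show ?thesis using AS by auto
qed

text \<open>\<open>R\<close> is an escape radius; \<open>c\<^sub>0\<close> absorbs the leading
  coefficient and the lower-order terms of \<open>f\<close> in the logarithm.\<close>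

locale escaping_poly =
  fixes f :: "complex poly" and R c\<^sub>0 :: real
  assumes deg: "degree f \<ge> 2"
    and R1: "R \<ge> 1"
    and escape: "norm z \<ge> R \<Longrightarrow> norm (poly f z) \<ge> 2 * norm z"
    and ln_escape: "norm z \<ge> R \<Longrightarrow> \<bar>ln (norm (poly f z)) - degree f * ln (norm z)\<bar> \<le> c\<^sub>0"

text \<open>The reversed polynomial at \<open>1 / z\<close> is
  \<open>poly f z / z ^ degree f\<close>, and its value at 0 is the leading coefficient; continuity
  at 0 gives both estimates.\<close>

lemma escaping_poly_exists:
  fixes f :: "complex poly"
  assumes deg: "degree f \<ge> 2"
  shows "\<exists>R c\<^sub>0. escaping_poly f R c\<^sub>0"
proof -
  let ?a = "norm (lead_coeff f)"
  have a: "?a > 0" using deg by auto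
  have "((\<lambda>w. norm (poly (reflect_poly f) w)) \<longlongrightarrow> norm (poly (reflect_poly f) 0)) (at 0)"
    by (intro tendsto_norm isContD poly_isCont)
  then have lim: "((\<lambda>w. norm (poly (reflect_poly f) w)) \<longlongrightarrow> ?a) (at 0)" by simp
  have "\<forall>\<^sub>F w in at 0. norm (poly (reflect_poly f) w) > ?a / 2 \<and> norm (poly (reflect_poly f) w) < 2 * ?a"
    by (intro eventually_conj order_tendstoD[OF lim]) (use a in auto)
  then obtain e where e: "e > 0" "\<And>w. w \<noteq> 0 \<Longrightarrow> norm w < e \<Longrightarrow> norm (poly (reflect_poly f) w) > ?a / 2 \<and> norm (poly (reflect_poly f) w) < 2 * ?a"
    unfolding eventually_at by auto
  \<comment> \<open>\<open>2 / e\<close> brings \<open>1 / z\<close> within \<open>e\<close> of 0,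
    and \<open>4 / ?a\<close> makes half of \<open>?a * norm z ^ degree f\<close> at least
    \<open>2 * norm z\<close>.\<close>
  define R where "R = max 1 (max (2 / e) (4 / ?a))"
  have R: "R \<ge> 1" "R \<ge> 2 / e" "R \<ge> 4 / ?a" unfolding R_def by auto
  have est: "?a / 2 * norm z ^ degree f \<le> norm (poly f z) \<and> norm (poly f z) \<le> 2 * ?a * norm z ^ degree f" if z: "norm z \<ge> R" for z
  proof -
    have z0: "norm z > 0" "z \<noteq> 0" using z R by auto
    have "norm z \<ge> 2 / e" using z R by linarith
    then have "norm z * e \<ge> 2" using e(1) by (simp add: field_simps)
    then have "1 < e * norm z" by (simp add: mult.commute)
    then have "norm (inverse z) < e" using z0(1) unfolding norm_inverse by (simp add: field_simps del: zero_less_norm_iff)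
    from e(2)[OF _ this] have "norm (poly (reflect_poly f) (inverse z)) > ?a / 2"
      "norm (poly (reflect_poly f) (inverse z)) < 2 * ?a" using z0 by auto
    moreover have "poly (reflect_poly f) (inverse z) = inverse z ^ degree f * poly f z"
      using z0 by (simp add: poly_reflect_poly_nz)
    then have "norm (poly f z) = norm z ^ degree f * norm (poly (reflect_poly f) (inverse z))"
      using z0 by (simp add: norm_mult norm_power norm_inverse flip: power_mult_distrib)
    ultimately show ?thesis using z0 by (simp add: field_simps)
  qed
  have "escaping_poly f R (\<bar>ln (?a / 2)\<bar> + \<bar>ln (2 * ?a)\<bar>)"
  proof
    fix z :: complex assume z: "norm z \<ge> R"
    have z0: "norm z > 0" "norm z \<ge> 1" using z R by auto
    have az: "?a * norm z \<ge> 4" using z R(3) a by (smt (verit) divide_le_eq mult.commute)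
    have "norm z ^ degree f \<ge> norm z ^ 2" by (rule power_increasing) (use deg z0 in auto)
    then have "?a / 2 * norm z ^ degree f \<ge> ?a / 2 * norm z ^ 2" using a by (intro mult_left_mono) auto
    moreover have "?a / 2 * norm z ^ 2 = (?a * norm z) * (norm z / 2)" by (simp add: power2_eq_square)
    moreover have "(?a * norm z) * (norm z / 2) \<ge> 4 * (norm z / 2)" using az by (intro mult_right_mono) auto
    ultimately show "norm (poly f z) \<ge> 2 * norm z" using est[OF z] by linarith
    have p: "norm z ^ degree f > 0" using z0 by simp
    have l1: "ln (?a / 2 * norm z ^ degree f) = ln (?a / 2) + degree f * ln (norm z)"
      using a z0 p by (simp only: ln_mult_pos ln_realpow half_gt_zero)
    have l2: "ln (2 * ?a * norm z ^ degree f) = ln (2 * ?a) + degree f * ln (norm z)"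
      using a z0 p by (simp only: ln_mult_pos ln_realpow zero_less_numeral zero_less_mult_iff simp_thms)
    have fp: "norm (poly f z) > 0" "?a / 2 * norm z ^ degree f > 0" using \<open>norm (poly f z) \<ge> 2 * norm z\<close> z0 a p by auto
    have "ln (?a / 2) + degree f * ln (norm z) \<le> ln (norm (poly f z))"
      unfolding l1[symmetric] using est[OF z] fp by (intro ln_mono) auto
    moreover have "ln (norm (poly f z)) \<le> ln (2 * ?a) + degree f * ln (norm z)"
      unfolding l2[symmetric] using est[OF z] fp by (intro ln_mono) auto
    ultimately show "\<bar>ln (norm (poly f z)) - degree f * ln (norm z)\<bar> \<le> \<bar>ln (?a / 2)\<bar> + \<bar>ln (2 * ?a)\<bar>" by linarith
  qed (use deg R in auto)
  then show ?thesis by blast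
qed

section \<open>Iterates and the topology of the filled Julia set\<close>

context escaping_poly
begin

definition iter :: "nat \<Rightarrow> complex poly" where
  "iter n = (pcompose f ^^ n) [:0, 1:]"

lemma iter_0 [simp]: "iter 0 = [:0, 1:]"
  and iter_Suc: "iter (Suc n) = pcompose f (iter n)"
  by (simp_all add: iter_def)

lemma poly_iter: "poly (iter n) z = (poly f ^^ n) z"
  by (induction n) (simp_all add: iter_Suc poly_pcompose)

lemma poly_iter_Suc: "poly (iter (Suc n)) z = poly f (poly (iter n) z)"
  by (simp add: iter_Suc poly_pcompose)

lemma poly_iter_Suc': "poly (iter (Suc n)) z = poly (iter n) (poly f z)"
  by (simp add: poly_iter funpow_swap1)

lemma poly_iter_add: "poly (iter (m + n)) z = poly (iter m) (poly (iter n) z)"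
  by (simp add: poly_iter funpow_add)

lemma degree_iter: "degree (iter n) = degree f ^ n"
  by (induction n) (simp_all add: iter_Suc degree_pcompose)

lemma degree_iter_pos: "degree (iter n) > 0"
  using deg by (simp add: degree_iter)

lemma lead_coeff_iter_Suc: "lead_coeff (iter (Suc n)) = lead_coeff f * lead_coeff (iter n) ^ degree f"
  by (simp add: iter_Suc lead_coeff_comp degree_iter_pos)

lemma norm_iter_gt: "norm (poly (iter m) z) > R \<Longrightarrow> norm (poly (iter (m + k)) z) \<ge> 2 ^ k * norm (poly (iter m) z)"
proof (induction k)
  case (Suc k)
  have "R \<le> 1 * norm (poly (iter m) z)" using Suc.prems by simp
  also have "\<dots> \<le> 2 ^ k * norm (poly (iter m) z)" by (intro mult_right_mono) auto
  finally have "R \<le> norm (poly (iter (m + k)) z)" using Suc by linarith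
  from escape[OF this] Suc show ?case by (simp add: poly_iter_Suc)
qed simp

lemma escaped_mono:
  assumes "norm (poly (iter m) z) > R" "m \<le> n"
  shows "norm (poly (iter n) z) > R"
proof -
  have "1 * norm (poly (iter m) z) \<le> 2 ^ (n - m) * norm (poly (iter m) z)" by (intro mult_right_mono) auto
  then show ?thesis using norm_iter_gt[OF assms(1), of "n - m"] assms by simp
qed

abbreviation "J \<equiv> filled_julia f"

lemma filled_julia_iff: "z \<in> J \<longleftrightarrow> (\<forall>n. norm (poly (iter n) z) \<le> R)"
proof
  assume "z \<in> J"
  then obtain B where B: "\<And>n. norm (poly (iter n) z) \<le> B"
    unfolding filled_julia_def bounded_iff by (auto simp: poly_iter)
  show "\<forall>n. norm (poly (iter n) z) \<le> R"
  proof (rule ccontr)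
    assume "\<not> ?thesis"
    then obtain m where m: "norm (poly (iter m) z) > R" by (auto simp: not_le)
    obtain k where k: "2 ^ k > B" using real_arch_pow[of 2 B] by auto
    have "2 ^ k * 1 \<le> 2 ^ k * norm (poly (iter m) z)" using m R1 by (intro mult_left_mono) auto
    then show False using norm_iter_gt[OF m, of k] B[of "m + k"] k by linarith
  qed
next
  assume "\<forall>n. norm (poly (iter n) z) \<le> R"
  then show "z \<in> J" unfolding filled_julia_def bounded_iff by (auto simp: poly_iter)
qed

lemma not_in_filled_julia_iff: "z \<notin> J \<longleftrightarrow> (\<exists>n. norm (poly (iter n) z) > R)"
  by (auto simp: filled_julia_iff not_le)

lemma norm_le_filled_julia: "z \<in> J \<Longrightarrow> norm z \<le> R"
  using filled_julia_iff[THEN iffD1, rule_format, of z 0] by simp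

lemma poly_in_filled_julia_iff: "poly f z \<in> J \<longleftrightarrow> z \<in> J"
proof
  assume *: "poly f z \<in> J"
  have "norm (poly (iter n) z) \<le> R" for n
  proof (rule ccontr)
    assume "\<not> ?thesis"
    then have "norm (poly (iter (Suc n)) z) > R" using escaped_mono[of n z "Suc n"] by simp
    moreover have "norm (poly (iter n) (poly f z)) \<le> R" using * by (simp add: filled_julia_iff)
    ultimately show False by (simp add: poly_iter_Suc')
  qed
  then show "z \<in> J" by (simp add: filled_julia_iff)
next
  assume "z \<in> J"
  then have "norm (poly (iter (Suc n)) z) \<le> R" for n by (simp only: filled_julia_iff)
  then show "poly f z \<in> J" by (simp add: filled_julia_iff poly_iter_Suc')
qed

lemma closed_norm_iter_le: "closed {z. norm (poly (iter n) z) \<le> R}"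
  by (intro closed_Collect_le continuous_intros)

lemma open_escaped: "open {z. norm (poly (iter n) z) > R}"
  by (intro open_Collect_less continuous_intros)

lemma compact_filled_julia: "compact J"
  unfolding compact_eq_bounded_closed
proof
  show "bounded J" using norm_le_filled_julia by (auto simp: bounded_iff)
  have "J = (\<Inter>n. {z. norm (poly (iter n) z) \<le> R})" by (auto simp: filled_julia_iff)
  then show "closed J" using closed_norm_iter_le by auto
qed

text \<open>The frontier of a bounded complementary component lies in \<open>J\<close>, where all
  iterates are bounded by \<open>R\<close>. The maximum modulus principle carries this bound into
  the component, which would then lie in \<open>J\<close>. Only the unbounded component
  remains.\<close>

lemma connected_compl_filled_julia: "connected (- J)"
proof -
  have cl: "closed J" using compact_filled_julia by (rule compact_imp_closed)
  have unb: "\<not> bounded C" if C: "C \<in> components (- J)" for C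
  proof
    assume b: "bounded C"
    have ne: "C \<noteq> {}" "C \<subseteq> - J" using in_components_nonempty[OF C] in_components_subset[OF C] by auto
    have fr: "frontier C \<subseteq> J"
      using frontier_of_components_closed_complement[OF cl C] frontier_subset_closed[OF cl] by blast
    obtain z where z: "z \<in> C" using ne by auto
    have "norm (poly (iter n) z) \<le> R" for n
    proof (rule maximum_modulus_frontier[of "poly (iter n)" C])
      show "norm (poly (iter n) w) \<le> R" if "w \<in> frontier C" for w
        using that fr filled_julia_iff by blast
    qed (use b z in \<open>auto intro!: holomorphic_intros continuous_intros\<close>)
    then have "z \<in> J" by (simp add: filled_julia_iff)
    then show False using z ne by auto
  qed
  have "C = C'" if C: "C \<in> components (- J)" "C' \<in> components (- J)" for C C'
  proof -
    obtain x y where xy: "C = connected_component_set (- J) x" "C' = connected_component_set (- J) y"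
      using C by (auto simp: components_def)
    show ?thesis using unb[OF C(1)] unb[OF C(2)] unfolding xy
      by (intro cobounded_unique_unbounded_component) (use compact_imp_bounded[OF compact_filled_julia] in auto)
  qed
  then have "\<exists>C. components (- J) \<subseteq> {C}" by blast
  then show ?thesis by (simp add: connected_eq_components_subset_sing_exists)
qed

text \<open>A clopen piece of \<open>S n\<close> maps onto the disc, so it contains a preimage of a
  chosen point of \<open>L\<close>, and this preimage is in \<open>L\<close> by total invariance. As
  \<open>L\<close> is connected, there is just one piece; \<open>J\<close> is the decreasing
  intersection of these compact connected sets.\<close>

lemma connected_filled_julia:
  assumes L: "connected L" "L \<noteq> {}" "L \<subseteq> J" and k: "k > 0" and inv: "poly (iter k) -` L = L"
  shows "connected J"
proof -
  define S where "S n = {z. norm (poly (iter (k * n)) z) \<le> R}" for n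
  have SR: "norm z \<le> R" if "z \<in> S n" for z n
    using that escaped_mono[of 0 z "k * n"] by (force simp: S_def not_le[symmetric])
  have cS: "compact (S n)" for n
    unfolding compact_eq_bounded_closed using SR closed_norm_iter_le by (auto simp: S_def bounded_iff)
  have nest: "S n \<subseteq> S m" if "m \<le> n" for m n
    using escaped_mono[of "k * m" _ "k * n"] that by (auto simp: S_def) (meson not_le mult_le_mono2)
  have inv': "poly (iter (k * n)) -` L = L" for n
  proof (induction n)
    case (Suc n)
    have "poly (iter (k * Suc n)) -` L = poly (iter (k * n)) -` (poly (iter k) -` L)"
      by (auto simp: poly_iter_add)
    then show ?case using Suc inv by simp
  qed simp
  have LS: "L \<subseteq> S n" for n using L(3) by (auto simp: S_def filled_julia_iff)
  obtain b where b: "b \<in> L" using L(2) by auto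
  have meets: "E \<inter> L \<noteq> {}" if E: "openin (top_of_set (S n)) E" "closedin (top_of_set (S n)) E" "E \<noteq> {}" for E n
  proof -
    have eq: "S n = poly (iter (k * n)) -` cball 0 R" by (auto simp: S_def)
    have "poly (iter (k * n)) ` E = cball 0 R"
    proof (rule poly_clopen_surj[OF degree_iter_pos])
      show "compact E" by (rule closedin_compact[OF cS E(2)])
    qed (use E eq in auto)
    moreover have "b \<in> cball 0 R" using norm_le_filled_julia[of b] b L(3) by auto
    ultimately have "b \<in> poly (iter (k * n)) ` E" by simp
    then obtain e where "e \<in> E" "poly (iter (k * n)) e = b" by (metis imageE)
    moreover from this have "e \<in> poly (iter (k * n)) -` L" using b by simp
    ultimately show ?thesis unfolding inv' by blast
  qed
  have "connected (S n)" for n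
    unfolding connected_clopen
  proof (intro allI impI, rule ccontr)
    fix T assume T: "openin (top_of_set (S n)) T \<and> closedin (top_of_set (S n)) T" and "\<not> (T = {} \<or> T = S n)"
    then have "T \<noteq> {}" "T \<noteq> S n" by auto
    moreover have "T \<subseteq> S n" using T openin_imp_subset by metis
    ultimately have ne: "T \<noteq> {}" "S n - T \<noteq> {}" by auto
    have T': "openin (top_of_set (S n)) (S n - T)" "closedin (top_of_set (S n)) (S n - T)"
      using T openin_diff[OF openin_subtopology_self, of _ T] closedin_diff[OF closedin_subtopology_refl[THEN iffD2], of _ _ T]
      by simp_all
    have op: "openin (top_of_set L) (L \<inter> X)" if X: "openin (top_of_set (S n)) X" for X
    proof -
      obtain W where W: "open W" "X = S n \<inter> W" using X unfolding openin_open by metis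
      have "L \<inter> X = L \<inter> W" using W(2) LS[of n] by auto
      then show ?thesis using W(1) by (simp add: openin_open_Int)
    qed
    have "openin (top_of_set L) (L \<inter> T)" "openin (top_of_set L) (L \<inter> (S n - T))"
      using op T T'(1) by simp_all
    moreover have "L \<inter> T \<noteq> {}" "L \<inter> (S n - T) \<noteq> {}"
      using meets[OF _ _ ne(1), of n] meets[OF T' ne(2)] T by (simp_all add: Int_commute)
    moreover have "L \<subseteq> (L \<inter> T) \<union> (L \<inter> (S n - T))" "(L \<inter> T) \<inter> (L \<inter> (S n - T)) = {}" using LS[of n] by auto
    ultimately show False using connected_openin[THEN iffD1, OF L(1)] by (simp only: not_ex) (metis (no_types))
  qed
  then have "connected (\<Inter> (range S))" using cS nest by (intro connected_nest)
  moreover have "\<Inter> (range S) = J"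
  proof
    show "\<Inter> (range S) \<subseteq> J"
    proof
      fix z assume z: "z \<in> \<Inter> (range S)"
      have "norm (poly (iter n) z) \<le> R" for n
      proof (rule ccontr)
        assume "\<not> ?thesis"
        then have "norm (poly (iter (k * n)) z) > R" using escaped_mono[of n z "k * n"] k by simp
        moreover have "z \<in> S n" using z by auto
        ultimately show False by (simp add: S_def)
      qed
      then show "z \<in> J" by (simp add: filled_julia_iff)
    qed
  qed (auto simp: S_def filled_julia_iff)
  ultimately show ?thesis by simp
qed

end

section \<open>The Green function and the Perron family\<close>

text \<open>Serves both charts: \<open>Q n\<close> is an iterate near finite points and a reversed
  iterate near infinity. A compact set lies in some \<open>V N\<close>; from there on the
  approximants are harmonic near it and converge uniformly.\<close>

lemma uniform_limit_ln_poly: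
  fixes Q :: "nat \<Rightarrow> complex poly" and s e :: "nat \<Rightarrow> real" and h :: "complex \<Rightarrow> real"
  assumes Vop: "\<And>n. open (V n)" and Vinc: "\<And>m n. m \<le> n \<Longrightarrow> V m \<subseteq> V n"
    and U: "open U" "U \<subseteq> (\<Union>n. V n)"
    and nz: "\<And>n z. z \<in> V n \<Longrightarrow> poly (Q n) z \<noteq> 0"
    and err: "\<And>n z. z \<in> V n \<Longrightarrow> \<bar>h z - s n * ln (norm (poly (Q n) z))\<bar> \<le> e n"
    and e: "e \<longlonglongrightarrow> 0"
  shows "continuous_on U h"
    and "\<And>a r. r > 0 \<Longrightarrow> cball a r \<subseteq> U \<Longrightarrow> ((\<lambda>t. h (a + of_real r * cis t)) has_integral 2 * pi * h a) {0..2*pi}"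
proof -
  have unif: "\<exists>N. S \<subseteq> V N \<and> uniform_limit S (\<lambda>n z. s (N + n) * ln (norm (poly (Q (N + n)) z))) h sequentially"
    if S: "compact S" "S \<subseteq> U" for S
  proof -
    obtain N where N: "S \<subseteq> V N"
    proof -
      obtain D where D: "finite D" "S \<subseteq> (\<Union>n\<in>D. V n)"
        using compactE_image[OF S(1), of UNIV V] Vop S(2) U(2) by (metis subset_trans)
      have "V n \<subseteq> V (Max (insert 0 D))" if "n \<in> D" for n using that D(1) by (intro Vinc) simp
      then show ?thesis using D(2) by (intro that[of "Max (insert 0 D)"]) blast
    qed
    have "uniform_limit S (\<lambda>n z. s (N + n) * ln (norm (poly (Q (N + n)) z))) h sequentially"
    proof (rule uniform_limitI)
      fix \<epsilon> :: real assume "\<epsilon> > 0"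
      with LIMSEQ_ignore_initial_segment[OF e, of N] have "\<forall>\<^sub>F n in sequentially. e (n + N) < \<epsilon>"
        by (rule order_tendstoD)
      then show "\<forall>\<^sub>F n in sequentially. \<forall>z\<in>S. dist (s (N + n) * ln (norm (poly (Q (N + n)) z))) (h z) < \<epsilon>"
      proof eventually_elim
        case (elim n)
        show ?case
        proof
          fix z assume "z \<in> S"
          then have "z \<in> V (N + n)" using N Vinc[of N "N + n"] by auto
          from err[OF this] elim show "dist (s (N + n) * ln (norm (poly (Q (N + n)) z))) (h z) < \<epsilon>"
            by (simp add: dist_real_def add.commute abs_minus_commute)
        qed
      qed
    qed
    with N show ?thesis by blast
  qed
  have cont: "continuous_on S (\<lambda>z. s n * ln (norm (poly (Q n) z)))" if "S \<subseteq> V n" for S n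
    using that nz by (intro continuous_intros) auto
  have contV: "continuous_on S (\<lambda>z. s (N + n) * ln (norm (poly (Q (N + n)) z)))" if "S \<subseteq> V N" for S N n
    using that Vinc[of N "N + n"] by (intro cont) auto
  have cS: "continuous_on S h" if S: "compact S" "S \<subseteq> U" for S
  proof -
    obtain N where N: "S \<subseteq> V N" "uniform_limit S (\<lambda>n z. s (N + n) * ln (norm (poly (Q (N + n)) z))) h sequentially"
      using unif[OF S] by blast
    show ?thesis using uniform_limit_theorem[OF _ N(2)] contV[OF N(1)] by auto
  qed
  show "continuous_on U h"
    unfolding continuous_on_eq_continuous_at[OF U(1)]
  proof
    fix x assume "x \<in> U"
    then obtain r where r: "r > 0" "cball x r \<subseteq> U" using U(1) open_contains_cball by blast
    from cS[OF compact_cball r(2)] show "isCont h x"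
      by (rule continuous_on_interior) (use r in auto)
  qed
  fix a r assume r: "(r::real) > 0" and ar: "cball a r \<subseteq> U"
  obtain N where N: "cball a r \<subseteq> V N" "uniform_limit (cball a r) (\<lambda>n z. s (N + n) * ln (norm (poly (Q (N + n)) z))) h sequentially"
    using unif[OF compact_cball ar] by blast
  let ?\<gamma> = "\<lambda>t. a + of_real r * cis t"
  have im: "?\<gamma> t \<in> cball a r" for t using r by (simp add: dist_norm norm_mult)
  let ?F = "\<lambda>n t. s (N + n) * ln (norm (poly (Q (N + n)) (?\<gamma> t)))"
  have "uniform_limit {0..2*pi} ?F (\<lambda>t. h (?\<gamma> t)) sequentially"
    using N(2) im unfolding uniform_limit_iff by (auto elim!: eventually_mono simp: Ball_def)
  moreover have "continuous_on {0..2*pi} (?F n)" for n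
    by (rule continuous_on_compose2[OF contV[OF N(1)]]) (use im in \<open>auto intro!: continuous_intros\<close>)
  ultimately obtain I X where I: "\<And>n. (?F n has_integral I n) {0..2*pi}"
    "((\<lambda>t. h (?\<gamma> t)) has_integral X) {0..2*pi}" "I \<longlonglongrightarrow> X"
    by (rule uniform_limit_integral) auto
  have "I n = 2 * pi * (s (N + n) * ln (norm (poly (Q (N + n)) a)))" for n
  proof (rule has_integral_unique[OF I(1)])
    have "poly (Q (N + n)) w \<noteq> 0" if "w \<in> cball a r" for w
      using N(1) that Vinc[of N "N + n"] by (intro nz) auto
    from has_integral_mult_right[OF mean_ln_poly[OF r this], where c = "s (N + n)"]
    show "(?F n has_integral 2 * pi * (s (N + n) * ln (norm (poly (Q (N + n)) a)))) {0..2*pi}"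
      by (simp add: algebra_simps)
  qed
  moreover have "(\<lambda>n. 2 * pi * (s (N + n) * ln (norm (poly (Q (N + n)) a)))) \<longlonglongrightarrow> 2 * pi * h a"
    using tendsto_uniform_limitI[OF N(2), of a] r by (intro tendsto_intros) auto
  ultimately have "I \<longlonglongrightarrow> 2 * pi * h a" by presburger
  then have "X = 2 * pi * h a" by (rule LIMSEQ_unique[OF I(3)])
  then show "((\<lambda>t. h (a + of_real r * cis t)) has_integral 2 * pi * h a) {0..2*pi}" using I(2) by simp
qed

lemma subharmonic_on_ln_max_affine_diff:
  assumes h: "continuous_on U h"
    "\<And>a r. r > 0 \<Longrightarrow> cball a r \<subseteq> U \<Longrightarrow> ((\<lambda>t. h (a + of_real r * cis t)) has_integral 2 * pi * h a) {0..2*pi}"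
    and nz: "\<And>w. max (norm (p + p' * w)) (norm (q + q' * w)) > 0"
  shows "subharmonic_on (\<lambda>w. ln (max (norm (p + p' * w)) (norm (q + q' * w))) - h w) U"
    (is "subharmonic_on (\<lambda>w. ?M w - h w) U")
proof -
  have cM: "continuous_on S ?M" for S
    by (intro continuous_intros ballI) (use nz in \<open>metis less_irrefl\<close>)
  show ?thesis unfolding subharmonic_on_def
  proof (intro conjI allI impI)
    show "continuous_on U (\<lambda>w. ?M w - h w)" by (intro continuous_intros cM h(1))
    fix a and r :: real assume r: "0 < r" "cball a r \<subseteq> U"
    have iM: "(\<lambda>t. ?M (a + of_real r * cis t)) integrable_on {0..2*pi}"
      by (intro integrable_continuous_real continuous_on_compose2[OF cM[of UNIV]] continuous_intros) auto
    have "integral {0..2*pi} (\<lambda>t. ?M (a + of_real r * cis t) - h (a + of_real r * cis t))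
        = integral {0..2*pi} (\<lambda>t. ?M (a + of_real r * cis t)) - 2 * pi * h a"
      using integral_diff[OF iM has_integral_integrable[OF h(2)[OF r]]] integral_unique[OF h(2)[OF r]] by simp
    then show "?M a - h a \<le> 1 / (2*pi) * integral {0..2*pi} (\<lambda>t. ?M (a + of_real r * cis t) - h (a + of_real r * cis t))"
      using submean_ln_max_affine[OF nz, of a r] by (simp add: field_simps)
  qed
qed

section \<open>The dynamical Green function in both charts\<close>

context escaping_poly
begin

abbreviation "d \<equiv> degree f"

definition log_rate :: "nat \<Rightarrow> complex \<Rightarrow> real" where
  "log_rate n z = ln (norm (poly (iter n) z)) / d ^ n"

text \<open>Convergence is asserted off \<open>J\<close> only; the values on \<open>J\<close> carry
  no information.\<close>

definition green :: "complex \<Rightarrow> real" where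
  "green z = lim (\<lambda>n. log_rate n z)"

lemma d2: "real d \<ge> 2" using deg by simp

lemma c0_nonneg: "c\<^sub>0 \<ge> 0"
  using ln_escape[of "of_real R"] R1 by force

lemma log_rate_step:
  assumes "norm (poly (iter n) z) > R"
  shows "\<bar>log_rate (Suc n) z - log_rate n z\<bar> \<le> c\<^sub>0 / d ^ Suc n"
proof -
  have dp: "real d > 0" using d2 by linarith
  have "log_rate (Suc n) z - log_rate n z
      = (ln (norm (poly f (poly (iter n) z))) - d * ln (norm (poly (iter n) z))) / d ^ Suc n"
    using dp by (simp add: log_rate_def poly_iter_Suc field_simps)
  also have "\<bar>\<dots>\<bar> \<le> c\<^sub>0 / d ^ Suc n"
    unfolding abs_divide using ln_escape[of "poly (iter n) z"] assms dp by (auto intro!: divide_right_mono)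
  finally show ?thesis .
qed

text \<open>The factor \<open>1 - 1 / d ^ k\<close> carries the geometric series through the
  induction: \<open>1 / d \<le> 1 - 1 / d\<close> for \<open>d \<ge> 2\<close>, so the constant
  stays \<open>c\<^sub>0\<close>.\<close>

lemma log_rate_diff:
  assumes "norm (poly (iter m) z) > R"
  shows "\<bar>log_rate (m + k) z - log_rate m z\<bar> \<le> c\<^sub>0 / d ^ m * (1 - 1 / d ^ k)"
proof (induction k)
  case (Suc k)
  have dp: "real d > 0" using d2 by linarith
  have "\<bar>log_rate (m + Suc k) z - log_rate (m + k) z\<bar> \<le> c\<^sub>0 / d ^ Suc (m + k)"
    using log_rate_step[OF escaped_mono[OF assms, of "m + k"]] by simp
  also have "\<dots> \<le> c\<^sub>0 / d ^ m * (1 / d ^ k - 1 / d ^ Suc k)"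
  proof -
    have "1 / real d \<le> 1 - 1 / d" using d2 by (simp add: field_simps)
    then have "c\<^sub>0 / d ^ (m + k) * (1 / real d) \<le> c\<^sub>0 / d ^ (m + k) * (1 - 1 / d)"
      using c0_nonneg dp by (intro mult_left_mono) auto
    then show ?thesis using dp by (simp add: field_simps power_add)
  qed
  finally show ?case using Suc by (simp add: algebra_simps)
qed simp

lemma log_rate_diff':
  assumes "norm (poly (iter m) z) > R" "n \<ge> m"
  shows "\<bar>log_rate n z - log_rate m z\<bar> \<le> c\<^sub>0 / d ^ m"
proof -
  have "c\<^sub>0 / d ^ m * (1 - 1 / d ^ (n - m)) \<le> c\<^sub>0 / d ^ m * 1"
    using c0_nonneg by (intro mult_left_mono) auto
  then show ?thesis using log_rate_diff[OF assms(1), of "n - m"] assms(2) by simp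
qed

lemma err_tendsto_0: "(\<lambda>n. b / d ^ n) \<longlonglongrightarrow> 0"
proof -
  have "(\<lambda>n. b * (1 / real d) ^ n) \<longlonglongrightarrow> b * 0"
    using d2 by (intro tendsto_mult tendsto_const LIMSEQ_realpow_zero) auto
  then show ?thesis by (simp add: power_divide)
qed

lemma log_rate_tendsto:
  assumes "z \<notin> J"
  shows "(\<lambda>n. log_rate n z) \<longlonglongrightarrow> green z"
proof -
  obtain m where m: "norm (poly (iter m) z) > R" using assms not_in_filled_julia_iff by blast
  have "Cauchy (\<lambda>n. log_rate n z)"
  proof (rule metric_CauchyI)
    fix e :: real assume "e > 0"
    with err_tendsto_0[of "2 * c\<^sub>0"] have "\<forall>\<^sub>F n in sequentially. 2 * c\<^sub>0 / d ^ n < e" by (rule order_tendstoD)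
    then obtain N where N: "\<And>n. n \<ge> N \<Longrightarrow> 2 * c\<^sub>0 / d ^ n < e" unfolding eventually_sequentially by blast
    define k where "k = max N m"
    have k: "norm (poly (iter k) z) > R" using escaped_mono[OF m, of k] unfolding k_def by simp
    show "\<exists>M. \<forall>i\<ge>M. \<forall>j\<ge>M. dist (log_rate i z) (log_rate j z) < e"
    proof (intro exI[of _ k] allI impI)
      fix i j assume "i \<ge> k" "j \<ge> k"
      then show "dist (log_rate i z) (log_rate j z) < e"
        using log_rate_diff'[OF k, of i] log_rate_diff'[OF k, of j] N[of k] unfolding dist_real_def k_def by force
    qed
  qed
  then show ?thesis unfolding green_def by (simp add: Cauchy_convergent convergent_LIMSEQ_iff[symmetric])
qed

lemma green_log_rate:
  assumes "norm (poly (iter m) z) > R"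
  shows "\<bar>green z - log_rate m z\<bar> \<le> c\<^sub>0 / d ^ m"
proof -
  have "z \<notin> J" using assms not_in_filled_julia_iff by blast
  from log_rate_tendsto[OF this] have "(\<lambda>n. \<bar>log_rate n z - log_rate m z\<bar>) \<longlonglongrightarrow> \<bar>green z - log_rate m z\<bar>"
    by (intro tendsto_intros)
  then show ?thesis by (rule LIMSEQ_le_const2) (use log_rate_diff'[OF assms] in blast)
qed

lemma green_nonneg:
  assumes "z \<notin> J"
  shows "green z \<ge> 0"
proof -
  obtain m where m: "norm (poly (iter m) z) > R" using assms not_in_filled_julia_iff by blast
  have "log_rate n z \<ge> 0" if "n \<ge> m" for n
    using escaped_mono[OF m that] R1 by (simp add: log_rate_def)
  then show ?thesis using log_rate_tendsto[OF assms] by (intro LIMSEQ_le_const) auto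
qed

lemma green_functional_eq:
  assumes "z \<notin> J"
  shows "green (poly f z) = d * green z"
proof (rule LIMSEQ_unique)
  show "(\<lambda>n. log_rate n (poly f z)) \<longlonglongrightarrow> green (poly f z)"
    using assms by (intro log_rate_tendsto) (simp add: poly_in_filled_julia_iff)
  have "log_rate n (poly f z) = d * log_rate (Suc n) z" for n
    using d2 by (auto simp: log_rate_def poly_iter_Suc')
  then show "(\<lambda>n. log_rate n (poly f z)) \<longlonglongrightarrow> d * green z"
    using LIMSEQ_Suc[OF log_rate_tendsto[OF assms]] by (auto intro!: tendsto_intros)
qed

lemma escaped_exhausts: "- J = (\<Union>n. {z. norm (poly (iter n) z) > R})"
  by (rule set_eqI) (simp add: not_in_filled_julia_iff)

lemma escaped_subset: "m \<le> n \<Longrightarrow> {z. norm (poly (iter m) z) > R} \<subseteq> {z. norm (poly (iter n) z) > R}"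
  using escaped_mono by auto

lemma open_compl_filled_julia: "open (- J)"
  using compact_imp_closed[OF compact_filled_julia] by (rule open_Compl)

lemma
  shows continuous_on_green: "continuous_on (- J) green"
    and mean_value_green: "r > 0 \<Longrightarrow> cball x r \<subseteq> - J \<Longrightarrow>
      ((\<lambda>t. green (x + of_real r * cis t)) has_integral 2 * pi * green x) {0..2*pi}"
proof -
  have nz: "poly (iter n) z \<noteq> 0" if "z \<in> {z. norm (poly (iter n) z) > R}" for n z
    using that R1 by auto
  have err: "\<bar>green z - 1 / d ^ n * ln (norm (poly (iter n) z))\<bar> \<le> c\<^sub>0 / d ^ n"
    if "z \<in> {z. norm (poly (iter n) z) > R}" for n z
    using green_log_rate[of n z] that by (simp add: log_rate_def)
  note * = uniform_limit_ln_poly[where V="\<lambda>n. {z. norm (poly (iter n) z) > R}",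
      OF open_escaped escaped_subset open_compl_filled_julia
      equalityD1[OF escaped_exhausts] nz err err_tendsto_0]
  show "continuous_on (- J) green" by (rule *(1))
  show "r > 0 \<Longrightarrow> cball x r \<subseteq> - J \<Longrightarrow>
      ((\<lambda>t. green (x + of_real r * cis t)) has_integral 2 * pi * green x) {0..2*pi}"
    by (rule *(2))
qed

text \<open>The value of \<open>green z - ln (norm z)\<close> at infinity, so minus the logarithm of
  the capacity of \<open>J\<close>. The functional equation forces
  \<open>ln (norm (lead_coeff f)) + robin = d * robin\<close>.\<close>

definition robin :: real where
  "robin = ln (norm (lead_coeff f)) / (d - 1)"

text \<open>The Green function in the coordinate \<open>1 / z\<close>, with its logarithmic pole at infinity removed.\<close>

definition green_inf :: "complex \<Rightarrow> real" where
  "green_inf w = (if w = 0 then robin else green (inverse w) + ln (norm w))"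

definition basin_inf :: "complex set" where
  "basin_inf = {w. w = 0 \<or> inverse w \<notin> J}"

lemma lead_coeff_nz: "lead_coeff f \<noteq> 0" using deg by auto

text \<open>The leading coefficient of the \<open>n\<close>-th iterate is that of \<open>f\<close>
  to the power \<open>(d ^ n - 1) / (d - 1)\<close>.\<close>

lemma ln_lead_coeff_iter: "ln (norm (lead_coeff (iter n))) / d ^ n = robin * (1 - 1 / d ^ n)"
proof (induction n)
  case (Suc n)
  have dp: "real d > 1" "real d > 0" using d2 by linarith+
  have nz: "lead_coeff (iter n) \<noteq> 0" using degree_iter_pos[of n] by auto
  have "ln (norm (lead_coeff (iter (Suc n)))) = ln (norm (lead_coeff f)) + d * ln (norm (lead_coeff (iter n)))"
    unfolding lead_coeff_iter_Suc norm_mult norm_power using lead_coeff_nz nz by (subst ln_mult) (auto simp: ln_realpow)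
  also have "ln (norm (lead_coeff f)) = robin * (d - 1)" using dp deg by (simp add: robin_def of_nat_diff)
  also have "ln (norm (lead_coeff (iter n))) = robin * (1 - 1 / d ^ n) * d ^ n"
    using Suc dp by (simp add: divide_eq_eq)
  also have "\<dots> = robin * (real d ^ n - 1)" using dp by (simp add: field_simps)
  also have "robin * (d - 1) + d * (robin * (real d ^ n - 1)) = robin * (real d ^ Suc n - 1)"
    using deg by (simp add: algebra_simps of_nat_diff)
  finally show ?case using dp by (simp add: field_simps)
qed simp

text \<open>Escape of \<open>1 / w\<close> at time \<open>n\<close>, multiplied by
  \<open>norm w ^ (d ^ n)\<close> so that the condition is open at \<open>w = 0\<close> as
  well.\<close>

definition escaped_inf :: "nat \<Rightarrow> complex set" where
  "escaped_inf n = {w. norm (poly (reflect_poly (iter n)) w) > R * norm w ^ (d ^ n)}"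

lemma poly_reflect_iter:
  "w \<noteq> 0 \<Longrightarrow> norm (poly (reflect_poly (iter n)) w) = norm w ^ (d ^ n) * norm (poly (iter n) (inverse w))"
  by (simp add: poly_reflect_poly_nz norm_mult norm_power degree_iter)

lemma escaped_inf_iff: "w \<in> escaped_inf n \<longleftrightarrow> w = 0 \<or> norm (poly (iter n) (inverse w)) > R"
proof (cases "w = 0")
  case True
  have "lead_coeff (iter n) \<noteq> 0" using degree_iter_pos[of n] by auto
  then show ?thesis using True deg by (simp add: escaped_inf_def zero_power)
next
  case False
  then have "norm w ^ (d ^ n) > 0" by simp
  then show ?thesis using False by (simp add: escaped_inf_def poly_reflect_iter mult.commute[of R])
qed

text \<open>Reversed iterates are nonzero at 0, so no pole appears and harmonicity at infinity comes
  from the same uniform limit. The error at \<open>w = 0\<close> is \<open>robin / d ^ n\<close>,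
  whence the added \<open>\<bar>robin\<bar>\<close>.\<close>

lemma
  shows open_basin_inf: "open basin_inf"
    and continuous_on_green_inf: "continuous_on basin_inf green_inf"
    and mean_value_green_inf: "r > 0 \<Longrightarrow> cball x r \<subseteq> basin_inf \<Longrightarrow>
      ((\<lambda>t. green_inf (x + of_real r * cis t)) has_integral 2 * pi * green_inf x) {0..2*pi}"
proof -
  have op: "open (escaped_inf n)" for n
    unfolding escaped_inf_def by (intro open_Collect_less continuous_intros)
  have sub: "escaped_inf m \<subseteq> escaped_inf n" if "m \<le> n" for m n
    using escaped_mono[OF _ that] by (auto simp: escaped_inf_iff)
  have un: "basin_inf = (\<Union>n. escaped_inf n)"
    by (auto simp: basin_inf_def escaped_inf_iff not_in_filled_julia_iff)
  show ob: "open basin_inf" unfolding un using op by auto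
  have nz: "poly (reflect_poly (iter n)) w \<noteq> 0" if "w \<in> escaped_inf n" for n w
  proof
    assume "poly (reflect_poly (iter n)) w = 0"
    with that have "R * norm w ^ (d ^ n) < 0" by (simp add: escaped_inf_def)
    moreover have "R * norm w ^ (d ^ n) \<ge> 0" using R1 by simp
    ultimately show False by simp
  qed
  have err: "\<bar>green_inf w - 1 / d ^ n * ln (norm (poly (reflect_poly (iter n)) w))\<bar> \<le> (c\<^sub>0 + \<bar>robin\<bar>) / d ^ n"
    if w: "w \<in> escaped_inf n" for n w
  proof (cases "w = 0")
    case True
    have dp: "real d ^ n > 0" using d2 by simp
    have "1 / d ^ n * ln (norm (poly (reflect_poly (iter n)) w)) = robin * (1 - 1 / d ^ n)"
      using ln_lead_coeff_iter[of n] True by simp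
    then have "green_inf w - 1 / d ^ n * ln (norm (poly (reflect_poly (iter n)) w)) = robin / d ^ n"
      using True by (simp add: green_inf_def right_diff_distrib)
    then show ?thesis using c0_nonneg dp by (simp add: divide_right_mono)
  next
    case False
    then have esc: "norm (poly (iter n) (inverse w)) > R" using w by (simp add: escaped_inf_iff)
    have pos: "norm w ^ (d ^ n) > 0" "norm (poly (iter n) (inverse w)) > 0" using False esc R1 by (auto simp: less_le_trans)
    have dp: "real d ^ n > 0" using d2 by simp
    have "ln (norm (poly (reflect_poly (iter n)) w)) = d ^ n * ln (norm w) + ln (norm (poly (iter n) (inverse w)))"
      unfolding poly_reflect_iter[OF False] using pos False by (simp add: ln_mult_pos ln_realpow)
    then have "1 / d ^ n * ln (norm (poly (reflect_poly (iter n)) w)) = ln (norm w) + log_rate n (inverse w)"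
      using dp by (simp add: log_rate_def field_simps)
    then have "\<bar>green_inf w - 1 / d ^ n * ln (norm (poly (reflect_poly (iter n)) w))\<bar> \<le> c\<^sub>0 / d ^ n"
      using green_log_rate[OF esc] False by (simp add: green_inf_def)
    also have "\<dots> \<le> (c\<^sub>0 + \<bar>robin\<bar>) / d ^ n" using dp by (intro divide_right_mono) auto
    finally show ?thesis .
  qed
  note * = uniform_limit_ln_poly[OF op sub ob equalityD1[OF un] nz err err_tendsto_0]
  show "continuous_on basin_inf green_inf" by (rule *(1))
  show "r > 0 \<Longrightarrow> cball x r \<subseteq> basin_inf \<Longrightarrow>
      ((\<lambda>t. green_inf (x + of_real r * cis t)) has_integral 2 * pi * green_inf x) {0..2*pi}"
    by (rule *(2))
qed

text \<open>Truncating at \<open>c\<close>, at most the distance from \<open>z\<close> to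
  \<open>J\<close>, removes the pole of \<open>ln (norm (w - z))\<close> without changing it on
  \<open>J\<close>. Subtracting \<open>green\<close> compensates the growth at infinity, leaves
  \<open>- robin\<close> there, and can only lower the values near \<open>J\<close>.\<close>

definition test_function :: "complex \<Rightarrow> real \<Rightarrow> complex option \<Rightarrow> real" where
  "test_function z c x = (case x of None \<Rightarrow> - robin | Some w \<Rightarrow> ln (max (norm (w - z)) c) - green w)"

lemma test_function_in_perron_family:
  assumes c: "c > 0" "\<And>w. w \<in> J \<Longrightarrow> norm (w - z) \<ge> c"
  shows "test_function z c \<in> perron_family J (\<lambda>w. ln (norm (w - z)))"
proof -
  let ?u = "test_function z c"
  have "subharmonic_on (\<lambda>w. ln (max (norm (- z + 1 * w)) (norm (of_real c + 0 * w))) - green w) (- J)"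
    by (rule subharmonic_on_ln_max_affine_diff[OF continuous_on_green mean_value_green]) (use c in \<open>auto simp: less_max_iff_disj\<close>)
  moreover have "(\<lambda>w. ln (max (norm (- z + 1 * w)) (norm (of_real c + 0 * w))) - green w) = ?u \<circ> Some"
    using c(1) by (auto simp: test_function_def fun_eq_iff)
  moreover have "Some -` (- Some ` J) = - J" by auto
  ultimately have 1: "subharmonic_on (?u \<circ> Some) (Some -` (- Some ` J))" by simp
  have "subharmonic_on (\<lambda>w. ln (max (norm (1 + (- z) * w)) (norm (0 + of_real c * w))) - green_inf w) basin_inf"
  proof (rule subharmonic_on_ln_max_affine_diff[OF continuous_on_green_inf mean_value_green_inf])
    fix w show "max (norm (1 + (- z) * w)) (norm (0 + of_real c * w)) > 0"
      using c(1) by (cases "w = 0") (auto simp: less_max_iff_disj)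
  qed
  moreover have "ln (max (norm (1 + (- z) * w)) (norm (0 + of_real c * w))) - green_inf w = (?u \<circ> chart_at_inf) w" for w
  proof (cases "w = 0")
    case False
    \<comment> \<open>The factor \<open>norm w\<close> clears the pole of the coordinate change; its
      logarithm is the term added in \<open>green_inf\<close>.\<close>
    have "norm (inverse w - z) * norm w = norm (1 + (- z) * w)"
      using False by (simp add: algebra_simps flip: norm_mult)
    then have "max (norm (1 + (- z) * w)) (norm (0 + of_real c * w)) = max (norm (inverse w - z)) c * norm w"
      using c(1) by (simp add: max_mult_distrib_right norm_mult)
    moreover have "max (norm (inverse w - z)) c > 0" using c(1) by (simp add: less_max_iff_disj)
    ultimately show ?thesis using False by (simp add: test_function_def chart_at_inf_def green_inf_def ln_mult_pos)
  qed (simp add: test_function_def chart_at_inf_def green_inf_def)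
  moreover have "chart_at_inf -` (- Some ` J) = basin_inf" by (auto simp: chart_at_inf_def basin_inf_def)
  ultimately have 2: "subharmonic_on (?u \<circ> chart_at_inf) (chart_at_inf -` (- Some ` J))"
    by (simp add: o_def)
  have 3: "Limsup (at \<zeta> within - J) (\<lambda>w. ereal (?u (Some w))) \<le> ereal (ln (norm (\<zeta> - z)))"
    if \<zeta>: "\<zeta> \<in> frontier J" for \<zeta>
  proof (cases "at \<zeta> within - J = bot")
    case False
    have "\<zeta> \<in> J" using \<zeta> frontier_subset_closed[OF compact_imp_closed[OF compact_filled_julia]] by auto
    then have cz: "norm (\<zeta> - z) \<ge> c" by (rule c(2))
    have "Limsup (at \<zeta> within - J) (\<lambda>w. ereal (?u (Some w))) \<le> Limsup (at \<zeta> within - J) (\<lambda>w. ereal (ln (max (norm (w - z)) c)))"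
      by (rule Limsup_mono) (auto simp: eventually_at_filter test_function_def green_nonneg)
    also have "\<dots> = ereal (ln (max (norm (\<zeta> - z)) c))"
      by (rule lim_imp_Limsup[OF False]) (use c(1) in \<open>auto intro!: tendsto_intros\<close>)
    finally show ?thesis using cz by simp
  qed simp
  show ?thesis using 1 2 3 by (simp add: perron_family_def sphere_subharmonic_on_def)
qed

lemma harmonic_measure_potential_lower:
  assumes hm: "is_harmonic_measure J \<omega>" and z: "z \<notin> J"
  shows "(LINT w:frontier J|\<omega>. ln (norm (w - z))) \<ge> - robin"
proof -
  obtain c where c: "c > 0" "\<And>w. w \<in> J \<Longrightarrow> norm (w - z) \<ge> c"
  proof -
    obtain c where "c > 0" "ball z c \<subseteq> - J" using open_compl_filled_julia z openE[of "- J" z] by auto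
    moreover from this have "c \<le> norm (w - z)" if "w \<in> J" for w
      using that by (force simp: subset_iff dist_norm norm_minus_commute not_less)
    ultimately show ?thesis by (intro that)
  qed
  have "continuous_on (frontier J) (\<lambda>w. ln (norm (w - z)))"
  proof (intro continuous_intros ballI)
    fix w assume "w \<in> frontier J"
    then have "w \<in> J" using frontier_subset_closed[OF compact_imp_closed[OF compact_filled_julia]] by auto
    then show "norm (w - z) \<noteq> 0" using c by force
  qed
  then have "ereal (LINT w:frontier J|\<omega>. ln (norm (w - z))) = (SUP u\<in>perron_family J (\<lambda>w. ln (norm (w - z))). ereal (u None))"
    using hm by (simp add: is_harmonic_measure_def)
  also have "\<dots> \<ge> ereal (test_function z c None)"
    by (rule SUP_upper[OF test_function_in_perron_family[OF c]])
  finally show ?thesis by (simp add: test_function_def)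
qed

end

section \<open>The logarithmic potential of the harmonic measure\<close>

lemma nonneg_mean_0_imp_0:
  fixes \<phi> :: "real \<Rightarrow> real"
  assumes "continuous_on {0..2*pi} \<phi>" "\<And>t. t \<in> {0..2*pi} \<Longrightarrow> \<phi> t \<ge> 0" "(\<phi> has_integral 0) {0..2*pi}" "t \<in> {0..2*pi}"
  shows "\<phi> t = 0"
  by (rule has_integral_0_cbox_imp_0[of 0 "2*pi" \<phi> t]) (use assms pi_gt_zero in \<open>auto simp: not_le\<close>)

section \<open>Boundary behaviour and asymptotics of the Green function\<close>

context escaping_poly
begin

lemma green_iter: "z \<notin> J \<Longrightarrow> green (poly (iter n) z) = d ^ n * green z \<and> poly (iter n) z \<notin> J"
  by (induction n) (simp_all add: poly_iter_Suc poly_in_filled_julia_iff green_functional_eq)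

text \<open>The first iterate outside the disc is the image of a point inside it, hence bounded by
  \<open>B\<close>; its Green function is \<open>d ^ n\<close> times \<open>green z\<close> and so
  dominates it.\<close>

lemma green_bounded_near_julia: "\<exists>C. \<forall>z. z \<notin> J \<longrightarrow> norm z \<le> R \<longrightarrow> green z \<le> C"
proof -
  have "bounded (poly f ` cball 0 R)"
    by (intro compact_imp_bounded compact_continuous_image continuous_intros compact_cball)
  then obtain B where B: "B > 0" "\<And>y. norm y \<le> R \<Longrightarrow> norm (poly f y) \<le> B"
    unfolding bounded_pos by auto
  have "green z \<le> \<bar>ln B\<bar> + c\<^sub>0" if z: "z \<notin> J" "norm z \<le> R" for z
  proof -
    define n where "n = (LEAST n. norm (poly (iter n) z) > R)"
    have n: "norm (poly (iter n) z) > R"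
      unfolding n_def using z(1) not_in_filled_julia_iff by (auto intro: LeastI)
    have "n \<noteq> 0" using n z(2) by (cases n) auto
    then obtain m where m: "n = Suc m" by (metis not0_implies_Suc)
    then have "norm (poly (iter m) z) \<le> R" using not_less_Least[of m "\<lambda>n. norm (poly (iter n) z) > R"] unfolding n_def by simp
    then have y: "norm (poly (iter n) z) \<le> B" using B(2) by (simp add: m poly_iter_Suc)
    let ?y = "poly (iter n) z"
    have "green ?y \<le> ln (norm ?y) + c\<^sub>0" using green_log_rate[of 0 ?y] n by (simp add: log_rate_def)
    also have "ln (norm ?y) \<le> ln B" using n R1 y by (intro ln_mono) auto
    finally have "green ?y \<le> \<bar>ln B\<bar> + c\<^sub>0" by linarith
    moreover have "green z \<le> d ^ n * green z"
      using green_nonneg[OF z(1)] deg by (simp add: mult_le_cancel_right1)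
    ultimately show ?thesis using green_iter[OF z(1), of n] by simp
  qed
  then show ?thesis by blast
qed

text \<open>Quantifies the vanishing of the Green function at \<open>J\<close>: a point still in the
  disc at time \<open>n\<close> has \<open>green z \<le> C / d ^ n\<close>.\<close>

lemma green_small_near_julia:
  assumes "\<epsilon> > 0"
  shows "\<exists>n. \<forall>z. z \<notin> J \<longrightarrow> norm (poly (iter n) z) \<le> R \<longrightarrow> green z < \<epsilon>"
proof -
  obtain C where C: "\<And>z. z \<notin> J \<Longrightarrow> norm z \<le> R \<Longrightarrow> green z \<le> C"
    using green_bounded_near_julia by blast
  from err_tendsto_0[of C] assms have "\<forall>\<^sub>F n in sequentially. C / d ^ n < \<epsilon>" by (rule order_tendstoD)
  then obtain n where n: "C / d ^ n < \<epsilon>" unfolding eventually_sequentially by blast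
  have "green z < \<epsilon>" if "z \<notin> J" "norm (poly (iter n) z) \<le> R" for z
  proof -
    have "d ^ n * green z \<le> C" using C[of "poly (iter n) z"] green_iter[OF that(1), of n] that(2) by simp
    then have "green z \<le> C / d ^ n" using deg by (simp add: field_simps)
    then show ?thesis using n by simp
  qed
  then show ?thesis by blast
qed

lemma green_at_infinity:
  assumes "\<epsilon> > 0"
  shows "\<exists>\<rho>. \<forall>z. norm z > \<rho> \<longrightarrow> z \<notin> J \<and> \<bar>green z - ln (norm z) - robin\<bar> < \<epsilon>"
proof -
  have "0 \<in> basin_inf" by (simp add: basin_inf_def)
  then have "isCont green_inf 0"
    using continuous_on_green_inf open_basin_inf by (simp add: continuous_on_eq_continuous_at)
  then obtain s where s: "s > 0" "\<And>w. norm w < s \<Longrightarrow> \<bar>green_inf w - green_inf 0\<bar> < \<epsilon>"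
    using assms unfolding continuous_at_eps_delta by (force simp: dist_norm)
  show ?thesis
  proof (intro exI[of _ "max R (1 / s)"] allI impI conjI)
    fix z :: complex assume z: "norm z > max R (1 / s)"
    then show "z \<notin> J" using norm_le_filled_julia[of z] by auto
    have z0: "norm z > 0" "z \<noteq> 0" using z R1 by auto
    have "1 < s * norm z" using z s(1) by (simp add: divide_less_eq mult.commute)
    then have "norm (inverse z) < s" using z0(1) unfolding norm_inverse by (simp add: field_simps del: zero_less_norm_iff)
    from s(2)[OF this] show "\<bar>green z - ln (norm z) - robin\<bar> < \<epsilon>"
      using z0 by (simp add: green_inf_def norm_inverse ln_inverse)
  qed
qed

end

section \<open>Potential and Green function near infinity\<close>

locale julia_harmonic = escaping_poly +
  fixes \<omega> :: "complex measure"
  assumes hm: "is_harmonic_measure J \<omega>"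
begin

sublocale prob_space \<omega> using hm by (simp add: is_harmonic_measure_def)

lemma sets_omega [measurable_cong]: "sets \<omega> = sets borel"
  using hm by (simp add: is_harmonic_measure_def)

lemma space_omega [simp]: "space \<omega> = UNIV"
  using sets_eq_imp_space_eq[OF sets_omega] by simp

lemma prob_UNIV [simp]: "prob UNIV = 1"
  using prob_space by simp

lemma closed_filled_julia: "closed J"
  using compact_filled_julia by (rule compact_imp_closed)

lemma julia_sets [measurable]: "J \<in> sets borel"
  using closed_filled_julia by auto

lemma AE_frontier: "AE w in \<omega>. w \<in> frontier J"
  using hm by (simp add: is_harmonic_measure_def)

lemma AE_julia: "AE w in \<omega>. w \<in> J"
  using AE_frontier frontier_subset_closed[OF closed_filled_julia] by (auto elim: eventually_mono)

lemma
  fixes g :: "complex \<Rightarrow> 'b::{banach, second_countable_topology}"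
  assumes g: "g \<in> borel_measurable borel" and B: "\<And>w. w \<in> J \<Longrightarrow> norm (g w) \<le> B"
  shows integrable_omega: "integrable \<omega> g" and norm_integral_omega_le: "norm (\<integral>w. g w \<partial>\<omega>) \<le> B"
proof -
  have AEB: "AE w in \<omega>. norm (g w) \<le> B" using AE_julia by (rule eventually_mono) (rule B)
  have gm: "g \<in> borel_measurable \<omega>" using g by simp
  show int: "integrable \<omega> g" by (rule integrable_const_bound[OF AEB gm])
  have "norm (\<integral>w. g w \<partial>\<omega>) \<le> (\<integral>w. norm (g w) \<partial>\<omega>)" by (rule integral_norm_bound)
  also have "\<dots> \<le> (\<integral>w. B \<partial>\<omega>)" by (rule integral_mono_AE) (use int AEB in auto)
  finally show "norm (\<integral>w. g w \<partial>\<omega>) \<le> B" by (simp add: prob_space)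
qed

definition potential :: "complex \<Rightarrow> real" where
  "potential z = (\<integral>w. ln (norm (z - w)) \<partial>\<omega>)"

lemma potential_lower: "z \<notin> J \<Longrightarrow> potential z \<ge> - robin"
proof -
  assume z: "z \<notin> J"
  have "(LINT w:frontier J|\<omega>. ln (norm (w - z))) = potential z"
    unfolding potential_def set_lebesgue_integral_def
  proof (rule integral_cong_AE)
    have [measurable]: "frontier J \<in> sets borel" by (intro borel_closed frontier_closed)
    show "(\<lambda>w. indicat_real (frontier J) w *\<^sub>R ln (norm (w - z))) \<in> borel_measurable \<omega>" by measurable
    show "(\<lambda>w. ln (norm (z - w))) \<in> borel_measurable \<omega>" by measurable
    show "AE w in \<omega>. indicat_real (frontier J) w *\<^sub>R ln (norm (w - z)) = ln (norm (z - w))"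
      using AE_frontier by (rule eventually_mono) (simp add: norm_minus_commute)
  qed
  then show ?thesis using harmonic_measure_potential_lower[OF hm z] by simp
qed

lemma kernel_bound:
  assumes S: "compact S" "S \<subseteq> - J"
  obtains B where "\<And>z w. z \<in> S \<Longrightarrow> w \<in> J \<Longrightarrow> \<bar>ln (norm (z - w))\<bar> \<le> B"
proof -
  have "continuous_on (S \<times> J) (\<lambda>p. ln (norm (fst p - snd p)))"
    using S(2) by (intro continuous_intros) auto
  from compact_imp_bounded[OF compact_continuous_image[OF this compact_Times[OF S(1) compact_filled_julia]]]
  obtain B where "\<forall>x\<in>(\<lambda>p. ln (norm (fst p - snd p))) ` (S \<times> J). norm x \<le> B" unfolding bounded_iff by blast
  then show ?thesis by (intro that[of B]) force
qed

lemma continuous_on_potential: "continuous_on (- J) potential"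
proof -
  have "isCont potential z" if z: "z \<in> - J" for z
  proof -
    obtain r where r: "r > 0" "cball z r \<subseteq> - J"
      using z open_contains_cball open_compl_filled_julia by blast
    obtain B where B: "\<And>y w. y \<in> cball z r \<Longrightarrow> w \<in> J \<Longrightarrow> \<bar>ln (norm (y - w))\<bar> \<le> B"
      using kernel_bound[OF compact_cball r(2)] by blast
    have "continuous_on (cball z r) potential"
      unfolding continuous_on_sequentially
    proof (intro allI ballI impI)
      fix x a assume a: "a \<in> cball z r" and x: "(\<forall>n. x n \<in> cball z r) \<and> x \<longlonglongrightarrow> a"
      show "(potential \<circ> x) \<longlonglongrightarrow> potential a"
        unfolding potential_def o_def
      proof (rule integral_dominated_convergence[where w = "\<lambda>_. B"])
        show "AE w in \<omega>. (\<lambda>i. ln (norm (x i - w))) \<longlonglongrightarrow> ln (norm (a - w))"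
          using AE_julia
        proof eventually_elim
          case (elim w)
          then have "norm (a - w) \<noteq> 0" using a r(2) by auto
          then show ?case using x by (intro tendsto_intros) auto
        qed
        show "AE w in \<omega>. norm (ln (norm (x i - w))) \<le> B" for i
          using AE_julia by eventually_elim (use B x in auto)
      qed auto
    qed
    then show ?thesis by (rule continuous_on_interior) (use r in auto)
  qed
  then show ?thesis by (simp add: continuous_at_imp_continuous_on)
qed

text \<open>Stated for a general curve because means are taken over circles about points off
  \<open>J\<close> and also over circles around \<open>J\<close>, parametrised by inversion.\<close>

lemma potential_fubini:
  fixes \<gamma> :: "real \<Rightarrow> complex"
  assumes \<gamma>: "continuous_on UNIV \<gamma>" "\<And>t. \<gamma> t \<notin> J"
    and m: "\<And>w. w \<in> J \<Longrightarrow> ((\<lambda>t. ln (norm (\<gamma> t - w))) has_integral m w) {0..2*pi}"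
    and mm: "m \<in> borel_measurable borel"
  shows "((\<lambda>t. potential (\<gamma> t)) has_integral (\<integral>w. m w \<partial>\<omega>)) {0..2*pi}"
proof -
  let ?M = "restrict_space lborel {0..2*pi}"
  \<comment> \<open>The indicator makes the kernel bounded on the whole product and changes it only
    on a null set of \<omega>.\<close>
  let ?h = "\<lambda>t w. indicat_real J w * ln (norm (\<gamma> t - w))"
  obtain B where B: "\<And>z w. z \<in> \<gamma> ` {0..2*pi} \<Longrightarrow> w \<in> J \<Longrightarrow> \<bar>ln (norm (z - w))\<bar> \<le> B"
    using kernel_bound[of "\<gamma> ` {0..2*pi}"] \<gamma>(2)
      compact_continuous_image[OF continuous_on_subset[OF \<gamma>(1) subset_UNIV] compact_Icc] by (metis ComplI image_subsetI)
  interpret M: finite_measure ?M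
    by (rule finite_measureI) (simp add: emeasure_restrict_space)
  interpret P: pair_sigma_finite ?M \<omega> ..
  interpret PF: finite_measure "?M \<Otimes>\<^sub>M \<omega>"
    by (rule finite_measure_pair_measure) (rule finite_measure_axioms, rule M.finite_measure_axioms)
  have \<gamma>m: "\<gamma> \<in> borel_measurable borel" using \<gamma>(1) by (rule borel_measurable_continuous_onI)
  have [measurable]: "\<gamma> \<in> borel_measurable ?M" using \<gamma>m by (intro measurable_restrict_space1) simp
  have hmeas: "case_prod ?h \<in> borel_measurable (?M \<Otimes>\<^sub>M \<omega>)" by measurable
  have cont: "continuous_on {0..2*pi} (\<lambda>t. potential (\<gamma> t))"
    by (rule continuous_on_compose2[OF continuous_on_potential continuous_on_subset[OF \<gamma>(1) subset_UNIV]]) (use \<gamma>(2) in auto)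
  have "integrable (?M \<Otimes>\<^sub>M \<omega>) (case_prod ?h)"
  proof (rule PF.integrable_const_bound[OF _ hmeas])
    show "AE x in ?M \<Otimes>\<^sub>M \<omega>. norm (case_prod ?h x) \<le> max B 0"
    proof (rule AE_I2)
      fix x assume "x \<in> space (?M \<Otimes>\<^sub>M \<omega>)"
      then have "fst x \<in> {0..2*pi}" by (auto simp: space_pair_measure space_restrict_space)
      then show "norm (case_prod ?h x) \<le> max B 0"
        using B[of "\<gamma> (fst x)" "snd x"] by (auto simp: split_beta indicator_def abs_mult)
    qed
  qed
  from P.Fubini_integral[OF this]
  have fub: "(\<integral>w. (\<integral>t. ?h t w \<partial>?M) \<partial>\<omega>) = (\<integral>t. (\<integral>w. ?h t w \<partial>\<omega>) \<partial>?M)" .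
  have inner: "(\<integral>w. ?h t w \<partial>\<omega>) = potential (\<gamma> t)" for t
    unfolding potential_def
  proof (rule integral_cong_AE)
    show "AE w in \<omega>. ?h t w = ln (norm (\<gamma> t - w))" using AE_julia by eventually_elim simp
  qed measurable
  have HK: "(\<integral>t. g t \<partial>?M) = integral {0..2*pi} g" if "continuous_on {0..2*pi} g" for g :: "real \<Rightarrow> real"
  proof -
    have "(\<integral>t. g t \<partial>?M) = (LINT t:{0..2*pi}|lborel. g t)"
      by (subst integral_restrict_space) (auto simp: set_lebesgue_integral_def)
    also have "\<dots> = integral {0..2*pi} g"
      by (rule set_borel_integral_eq_integral) (rule borel_integrable_atLeastAtMost'[OF that])
    finally show ?thesis .
  qed
  have outer: "(\<integral>t. ?h t w \<partial>?M) = m w" if w: "w \<in> J" for w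
  proof -
    have "continuous_on {0..2*pi} (\<lambda>t. ln (norm (\<gamma> t - w)))"
      using \<gamma>(2) w by (intro continuous_intros continuous_on_subset[OF \<gamma>(1) subset_UNIV]) auto
    from HK[OF this] show ?thesis using w integral_unique[OF m[OF w]] by simp
  qed
  have "integral {0..2*pi} (\<lambda>t. potential (\<gamma> t)) = (\<integral>t. potential (\<gamma> t) \<partial>?M)" using HK[OF cont] by simp
  also have "\<dots> = (\<integral>w. (\<integral>t. ?h t w \<partial>?M) \<partial>\<omega>)" using fub by (simp add: inner)
  also have "\<dots> = (\<integral>w. m w \<partial>\<omega>)"
  proof (rule integral_cong_AE)
    show "AE w in \<omega>. (\<integral>t. ?h t w \<partial>?M) = m w" using AE_julia by eventually_elim (rule outer)
    have "(\<lambda>(w, t). ?h t w) \<in> borel_measurable (\<omega> \<Otimes>\<^sub>M ?M)" by measurable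
    then show "(\<lambda>w. \<integral>t. ?h t w \<partial>?M) \<in> borel_measurable \<omega>"
      by (rule M.borel_measurable_lebesgue_integral)
    show "m \<in> borel_measurable \<omega>" using mm by simp
  qed
  finally show ?thesis
    using integrable_continuous_real[OF cont] by (simp add: has_integral_integral)
qed

lemma mean_value_potential:
  assumes r: "r > 0" and sub: "cball x r \<subseteq> - J"
  shows "((\<lambda>t. potential (x + of_real r * cis t)) has_integral 2 * pi * potential x) {0..2*pi}"
proof -
  have "((\<lambda>t. potential (x + of_real r * cis t)) has_integral (\<integral>w. 2 * pi * ln (norm (x - w)) \<partial>\<omega>)) {0..2*pi}"
  proof (rule potential_fubini)
    show "x + of_real r * cis t \<notin> J" for t
      using sub r by (auto simp: subset_iff dist_norm norm_mult)
    fix w assume "w \<in> J"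
    then have "norm (x - w) > r" using sub by (auto simp: subset_iff dist_norm) (meson not_le)
    then have "((\<lambda>t. ln (norm ((x - w) + of_real r * cis t))) has_integral 2 * pi * ln (norm (x - w))) {0..2*pi}"
      by (intro mean_ln_affine_less) (use r in simp)
    then show "((\<lambda>t. ln (norm (x + of_real r * cis t - w))) has_integral 2 * pi * ln (norm (x - w))) {0..2*pi}"
      by (simp add: algebra_simps)
  qed (auto intro!: continuous_intros)
  then show ?thesis by (simp add: potential_def)
qed

text \<open>\<open>ln (norm (z - w)) - ln (norm z)\<close> is the real part of
  \<open>Ln (1 - w / z)\<close>; the 2 comes from \<open>norm (Ln (1 + s)) \<le> 2 * norm s\<close>
  for \<open>norm s < 1 / 2\<close>.\<close>

lemma potential_at_infinity:
  assumes z: "norm z > 2 * R"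
  shows "\<bar>potential z - ln (norm z)\<bar> \<le> 2 * R / norm z"
proof -
  have z0: "norm z > 0" "z \<noteq> 0" using z R1 by auto
  have zJ: "z \<notin> J" using norm_le_filled_julia[of z] z R1 by auto
  have est: "\<bar>ln (norm (z - w)) - ln (norm z)\<bar> \<le> 2 * R / norm z" if w: "w \<in> J" for w
  proof -
    define s where "s = - w / z"
    have ns: "norm s \<le> R / norm z" unfolding s_def using norm_le_filled_julia[OF w] z0 by (simp add: norm_divide divide_right_mono)
    also have "\<dots> < 1 / 2" using z z0 by (simp add: field_simps)
    finally have s2: "norm s < 1 / 2" .
    have eq: "z - w = z * (1 + s)" using z0 by (simp add: s_def field_simps)
    have "z \<noteq> w" using zJ w by auto
    then have s1: "1 + s \<noteq> 0" using eq by auto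
    have "ln (norm (z - w)) - ln (norm z) = Re (Ln (1 + s))" unfolding eq using z0 s1 by (simp add: norm_mult ln_mult)
    also have "\<bar>\<dots>\<bar> \<le> norm (Ln (1 + s))" by (rule abs_Re_le_cmod)
    also have "\<dots> \<le> 2 * norm s" by (rule norm_Ln_le[OF s2])
    finally show ?thesis using ns by simp
  qed
  obtain B where B: "\<And>w. w \<in> J \<Longrightarrow> \<bar>ln (norm (z - w))\<bar> \<le> B"
  proof (rule kernel_bound[of "{z}"])
    show "thesis" if "\<And>B. (\<And>w. w \<in> J \<Longrightarrow> \<bar>ln (norm (z - w))\<bar> \<le> B) \<Longrightarrow> thesis"
      "\<And>y w. y \<in> {z} \<Longrightarrow> w \<in> J \<Longrightarrow> \<bar>ln (norm (y - w))\<bar> \<le> B" for B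
      by (rule that(1)[of B]) (use that(2)[of z] in simp)
  qed (use zJ in auto)
  have int: "integrable \<omega> (\<lambda>w. ln (norm (z - w)))" by (rule integrable_omega[of _ B]) (use B in auto)
  have "potential z - ln (norm z) = (\<integral>w. ln (norm (z - w)) - ln (norm z) \<partial>\<omega>)"
    unfolding potential_def using int by (simp add: prob_space)
  also have "\<bar>\<dots>\<bar> \<le> 2 * R / norm z"
    using norm_integral_omega_le[of "\<lambda>w. ln (norm (z - w)) - ln (norm z)" "2 * R / norm z"] est by simp
  finally show ?thesis .
qed

definition defect :: "complex \<Rightarrow> real" where
  "defect z = potential z + robin - green z"

lemma continuous_on_defect: "continuous_on (- J) defect"
  unfolding defect_def by (intro continuous_intros continuous_on_potential continuous_on_green)

lemma mean_value_defect:
  assumes "r > 0" "cball x r \<subseteq> - J"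
  shows "((\<lambda>t. defect (x + of_real r * cis t)) has_integral 2 * pi * defect x) {0..2*pi}"
  using has_integral_diff[OF has_integral_add[OF mean_value_potential[OF assms] has_integral_const_real[of robin 0 "2*pi"]] mean_value_green[OF assms]]
  by (simp add: defect_def algebra_simps)

lemma defect_at_infinity:
  assumes "\<epsilon> > 0"
  shows "\<exists>\<rho>. \<forall>z. norm z > \<rho> \<longrightarrow> \<bar>defect z\<bar> < \<epsilon>"
proof -
  obtain \<rho> where \<rho>: "\<And>z. norm z > \<rho> \<Longrightarrow> \<bar>green z - ln (norm z) - robin\<bar> < \<epsilon> / 2"
    using green_at_infinity[of "\<epsilon> / 2"] assms by auto
  show ?thesis
  proof (intro exI[of _ "max \<rho> (max (2 * R) (4 * R / \<epsilon>))"] allI impI)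
    fix z :: complex assume z: "norm z > max \<rho> (max (2 * R) (4 * R / \<epsilon>))"
    then have z0: "norm z > 0" using R1 by auto
    have "4 * R < norm z * \<epsilon>" using z assms by (simp add: divide_less_eq)
    then have "2 * R / norm z < \<epsilon> / 2" using z0 by (simp add: field_simps del: zero_less_norm_iff)
    moreover have "\<bar>green z - ln (norm z) - robin\<bar> < \<epsilon> / 2" "\<bar>potential z - ln (norm z)\<bar> \<le> 2 * R / norm z"
      using \<rho>[of z] potential_at_infinity[of z] z by simp_all
    ultimately show "\<bar>defect z\<bar> < \<epsilon>" unfolding defect_def by linarith
  qed
qed

text \<open>A minimum principle without boundary values: where the defect is at most a negative
  level, the point is far from infinity, where the defect tends to 0, and from \<open>J\<close>,
  where \<open>potential z + robin \<ge> 0\<close> and \<open>green\<close> is small. A negative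
  infimum is therefore attained on a compact set off \<open>J\<close>.\<close>

lemma defect_nonneg:
  assumes "z\<^sub>0 \<notin> J"
  shows "defect z\<^sub>0 \<ge> 0"
proof (rule ccontr)
  assume neg: "\<not> defect z\<^sub>0 \<ge> 0"
  define \<delta> where "\<delta> = - defect z\<^sub>0"
  have \<delta>: "\<delta> > 0" "defect z\<^sub>0 = - \<delta>" using neg by (auto simp: \<delta>_def)
  obtain \<rho> where \<rho>: "\<And>z. norm z > \<rho> \<Longrightarrow> \<bar>defect z\<bar> < \<delta>" using defect_at_infinity[OF \<delta>(1)] by blast
  obtain n where n: "\<And>z. z \<notin> J \<Longrightarrow> norm (poly (iter n) z) \<le> R \<Longrightarrow> green z < \<delta>"
    using green_small_near_julia[OF \<delta>(1)] by blast
  define T where "T = cball 0 \<rho> \<inter> {z. norm (poly (iter n) z) \<ge> R}"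
  have cT: "compact T" unfolding T_def
    by (intro compact_Int_closed compact_cball closed_Collect_le continuous_intros)
  have TJ: "T \<subseteq> - J"
  proof
    fix z assume "z \<in> T"
    then have z: "norm (poly (iter n) z) \<ge> R" by (simp add: T_def)
    \<comment> \<open>The non-strict inequality in \<open>T\<close> keeps it closed; one further
      iteration makes it strict.\<close>
    from escape[OF this] have "norm (poly (iter (Suc n)) z) > R" using z R1 by (simp add: poly_iter_Suc)
    then show "z \<in> - J" by (auto simp: not_in_filled_julia_iff simp del: not_less)
  qed
  have inT: "z \<in> T" if z: "z \<notin> J" "defect z \<le> - \<delta>" for z
  proof -
    have "norm z \<le> \<rho>" using \<rho>[of z] z(2) by (cases "norm z \<le> \<rho>") auto
    moreover have "green z \<ge> \<delta>" using potential_lower[OF z(1)] z(2) unfolding defect_def by linarith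
    then have "norm (poly (iter n) z) \<ge> R" using n[OF z(1)] by linarith
    ultimately show ?thesis by (simp add: T_def)
  qed
  have cDT: "continuous_on T defect" using continuous_on_defect TJ by (rule continuous_on_subset)
  have z0T: "z\<^sub>0 \<in> T" using inT[OF assms] \<delta> by simp
  obtain m where m: "m \<in> T" "\<And>z. z \<in> T \<Longrightarrow> defect m \<le> defect z"
    using continuous_attains_inf[OF cT _ cDT] z0T by blast
  have m\<delta>: "defect m \<le> - \<delta>" using m(2)[OF z0T] \<delta> by simp
  have min: "defect m \<le> defect z" if "z \<notin> J" for z
    using inT[OF that] m(2)[of z] m\<delta> by linarith
  define T' where "T' = {z\<in>T. defect z = defect m}"
  have "compact T'"
  proof -
    have "closed T'" unfolding T'_def
      using continuous_closed_preimage_constant[OF cDT compact_imp_closed[OF cT]] by simp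
    moreover have "T' \<subseteq> T" by (auto simp: T'_def)
    ultimately show ?thesis using cT closed_Int_compact[of T' T] by (simp add: inf_absorb1)
  qed
  moreover have "T' \<noteq> {}" using m by (auto simp: T'_def)
  \<comment> \<open>A rightmost minimum point replaces a connectedness argument: by the mean value
    property a small circle about it consists of minimum points, one of them further to the
    right.\<close>
  ultimately obtain z where z: "z \<in> T'" "\<And>y. y \<in> T' \<Longrightarrow> Re y \<le> Re z"
    using continuous_attains_sup[of T' Re] continuous_on_Re[OF continuous_on_id, of T'] by (auto simp: id_def)
  have zJ: "z \<in> - J" and zm: "defect z = defect m" using z(1) TJ by (auto simp: T'_def)
  obtain r where r: "r > 0" "cball z r \<subseteq> - J" using zJ open_contains_cball open_compl_filled_julia by blast
  let ?\<gamma> = "\<lambda>t. z + of_real r * cis t"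
  have \<gamma>: "?\<gamma> t \<notin> J" for t using r by (auto simp: subset_iff dist_norm norm_mult)
  have "defect (?\<gamma> 0) - defect m = 0"
  proof (rule nonneg_mean_0_imp_0[of "\<lambda>t. defect (?\<gamma> t) - defect m"])
    show "continuous_on {0..2*pi} (\<lambda>t. defect (?\<gamma> t) - defect m)"
      by (intro continuous_intros continuous_on_compose2[OF continuous_on_defect]) (use \<gamma> in auto)
    show "((\<lambda>t. defect (?\<gamma> t) - defect m) has_integral 0) {0..2*pi}"
      using has_integral_diff[OF mean_value_defect[OF r] has_integral_const_real[of "defect m" 0 "2*pi"]] zm by simp
  qed (use min \<gamma> in auto)
  then have eq: "defect (z + of_real r) = defect m" and "z + of_real r \<notin> J" using \<gamma>[of 0] by auto
  then have "z + of_real r \<in> T'" using inT[of "z + of_real r"] m\<delta> by (auto simp: T'_def)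
  from z(2)[OF this] show False using r(1) by simp
qed

text \<open>Over the circle of radius \<open>norm z\<close> the potential has mean
  \<open>ln (norm z)\<close>, as \<open>J\<close> lies inside, and \<open>green\<close> has mean
  \<open>robin + ln (norm z)\<close>, by the mean value property of \<open>green_inf\<close> at 0.
  So the nonnegative defect has mean 0 there.\<close>

lemma potential_eq_green:
  assumes z: "norm z > R"
  shows "potential z = green z - robin"
proof -
  define r where "r = 1 / norm z"
  have z0: "norm z > 0" "z \<noteq> 0" using z R1 by auto
  have r: "r > 0" using z0 by (simp add: r_def)
  let ?\<gamma> = "\<lambda>t. inverse (of_real r * cis t)"
  have n\<gamma>: "norm (?\<gamma> t) = norm z" for t using r by (simp add: norm_mult norm_inverse norm_divide r_def)
  have \<gamma>J: "?\<gamma> t \<notin> J" for t using norm_le_filled_julia[of "?\<gamma> t"] n\<gamma>[of t] z by auto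
  have c\<gamma>: "continuous_on S ?\<gamma>" for S using r by (intro continuous_intros) auto
  have sub: "cball 0 r \<subseteq> basin_inf"
  proof
    fix w :: complex assume w: "w \<in> cball 0 r"
    show "w \<in> basin_inf"
    proof (cases "w = 0")
      case False
      have "norm w * norm z \<le> 1" using w z0 by (simp add: r_def field_simps del: zero_less_norm_iff)
      then have "norm (inverse w) \<ge> norm z"
        using False unfolding norm_inverse by (simp add: field_simps)
      then have "norm (inverse w) > R" using z by linarith
      then show ?thesis using norm_le_filled_julia[of "inverse w"] by (auto simp: basin_inf_def)
    qed (simp add: basin_inf_def)
  qed
  have "((\<lambda>t. green_inf (0 + of_real r * cis t) - ln r) has_integral 2 * pi * green_inf 0 - (2 * pi - 0) *\<^sub>R ln r) {0..2*pi}"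
    by (intro has_integral_diff mean_value_green_inf r sub) (use has_integral_const_real[of "ln r" 0 "2*pi"] in simp)
  then have Ig: "((\<lambda>t. green (?\<gamma> t)) has_integral 2 * pi * (robin - ln r)) {0..2*pi}"
    using r by (simp add: green_inf_def norm_mult algebra_simps)
  have "((\<lambda>t. potential (?\<gamma> t)) has_integral (\<integral>w. 2 * pi * ln (norm z) \<partial>\<omega>)) {0..2*pi}"
  proof (rule potential_fubini[OF c\<gamma> \<gamma>J])
    fix w assume w: "w \<in> J"
    have "norm (of_real (norm z) + (- w) * cis t) = norm (?\<gamma> t - w)" for t
    proof -
      have "?\<gamma> t * cis t = of_real (norm z)" using r by (simp add: r_def field_simps)
      then have "of_real (norm z) + (- w) * cis t = (?\<gamma> t - w) * cis t" by (simp add: left_diff_distrib)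
      then show ?thesis by (simp only: norm_mult norm_cis mult_1_right)
    qed
    moreover have "((\<lambda>t. ln (norm (of_real (norm z) + (- w) * cis t))) has_integral 2 * pi * ln (norm (of_real (norm z) :: complex))) {0..2*pi}"
      by (rule mean_ln_affine_less) (use norm_le_filled_julia[OF w] z in simp)
    ultimately show "((\<lambda>t. ln (norm (?\<gamma> t - w))) has_integral 2 * pi * ln (norm z)) {0..2*pi}" by simp
  qed simp
  then have Ip: "((\<lambda>t. potential (?\<gamma> t)) has_integral 2 * pi * ln (norm z)) {0..2*pi}" by (simp add: prob_space)
  have "((\<lambda>t. defect (?\<gamma> t)) has_integral 2 * pi * ln (norm z) + 2 * pi * robin - 2 * pi * (robin - ln r)) {0..2*pi}"
    unfolding defect_def
    by (intro has_integral_diff has_integral_add Ip Ig) (use has_integral_const_real[of robin 0 "2*pi"] in simp)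
  moreover have "ln r = - ln (norm z)" using z0 by (simp add: r_def ln_div)
  ultimately have I0: "((\<lambda>t. defect (?\<gamma> t)) has_integral 0) {0..2*pi}" by (simp add: algebra_simps)
  let ?t = "Arg2pi (inverse z)"
  have "defect (?\<gamma> ?t) = 0"
  proof (rule nonneg_mean_0_imp_0[OF _ _ I0])
    show "continuous_on {0..2*pi} (\<lambda>t. defect (?\<gamma> t))"
      by (rule continuous_on_compose2[OF continuous_on_defect c\<gamma>]) (use \<gamma>J in auto)
    show "?t \<in> {0..2*pi}" using Arg2pi[of "inverse z"] by auto
  qed (rule defect_nonneg[OF \<gamma>J])
  moreover have "of_real r * cis ?t = inverse z"
    using Arg2pi_eq[of "inverse z"] by (simp add: r_def cis_conv_exp norm_inverse divide_inverse)
  ultimately show ?thesis by (simp add: defect_def)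
qed

lemma potential_functional_eq:
  assumes z: "norm z > R"
  shows "potential (poly f z) = d * potential z + ln (norm (lead_coeff f))"
proof -
  have zJ: "z \<notin> J" using norm_le_filled_julia[of z] z by auto
  have "norm (poly f z) > R" using escape[of z] z R1 by simp
  moreover have "ln (norm (lead_coeff f)) = (d - 1) * robin" using deg by (simp add: robin_def of_nat_diff)
  ultimately have "potential (poly f z) = d * green z - robin" "ln (norm (lead_coeff f)) = d * robin - robin"
    using potential_eq_green[of "poly f z"] green_functional_eq[OF zJ] deg by (simp_all add: algebra_simps of_nat_diff)
  then show ?thesis unfolding potential_eq_green[OF z] by (simp add: algebra_simps)
qed

end

section \<open>Components\<close>

lemma ln_norm_prod_linear_factors:
  fixes M :: "complex multiset"
  assumes "\<And>x. x \<in># M \<Longrightarrow> z \<noteq> x"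
  shows "ln (norm (poly (\<Prod>x\<in>#M. [:- x, 1:]) z)) = (\<Sum>x\<in>#M. ln (norm (z - x)))"
    and "poly (\<Prod>x\<in>#M. [:- x, 1:]) z \<noteq> 0"
proof -
  have "ln (norm (poly (\<Prod>x\<in>#M. [:- x, 1:]) z)) = (\<Sum>x\<in>#M. ln (norm (z - x))) \<and> poly (\<Prod>x\<in>#M. [:- x, 1:]) z \<noteq> 0"
    using assms
  proof (induction M)
    case (add a M)
    then have "z \<noteq> a" and IH: "ln (norm (poly (\<Prod>x\<in>#M. [:- x, 1:]) z)) = (\<Sum>x\<in>#M. ln (norm (z - x)))"
      "poly (\<Prod>x\<in>#M. [:- x, 1:]) z \<noteq> 0" by auto
    have "poly (\<Prod>x\<in>#add_mset a M. [:- x, 1:]) z = (z - a) * poly (\<Prod>x\<in>#M. [:- x, 1:]) z"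
      by (simp add: algebra_simps)
    then show ?case using IH \<open>z \<noteq> a\<close> by (simp add: norm_mult ln_mult)
  qed simp
  then show "ln (norm (poly (\<Prod>x\<in>#M. [:- x, 1:]) z)) = (\<Sum>x\<in>#M. ln (norm (z - x)))"
    and "poly (\<Prod>x\<in>#M. [:- x, 1:]) z \<noteq> 0" by auto
qed

text \<open>The factorisation of \<open>p - [:\<zeta>:]\<close> at \<open>z\<close>: summing over a
  fibre turns the kernel with pole \<open>z\<close> into the kernel with pole
  \<open>poly p z\<close>, up to a constant.\<close>

lemma root_sum_ln_norm:
  assumes deg: "degree p > 0" and z: "poly p z \<noteq> \<zeta>"
  shows "root_sum p (\<lambda>x. ln (norm (z - x))) \<zeta> = ln (norm (poly p z - \<zeta>)) - ln (norm (lead_coeff p))"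
proof -
  let ?p = "p - [:\<zeta>:]"
  have lc: "lead_coeff ?p = lead_coeff p" by (rule lead_coeff_diff_const[OF deg])
  have lcnz: "lead_coeff p \<noteq> 0" using deg by auto
  have nz: "z \<noteq> x" if "x \<in># proots ?p" for x
  proof
    assume "z = x"
    moreover have "poly ?p x = 0" using that by (cases "?p = 0") auto
    ultimately show False using z by simp
  qed
  have "poly p z - \<zeta> = poly ?p z" by simp
  also have "\<dots> = lead_coeff p * poly (\<Prod>x\<in>#proots ?p. [:- x, 1:]) z"
    by (subst complex_poly_decompose_multiset[of ?p, symmetric]) (simp only: lc poly_smult)
  finally have "norm (poly p z - \<zeta>) = norm (lead_coeff p) * norm (poly (\<Prod>x\<in>#proots ?p. [:- x, 1:]) z)"
    by (simp add: norm_mult)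
  then have "ln (norm (poly p z - \<zeta>)) = ln (norm (lead_coeff p)) + ln (norm (poly (\<Prod>x\<in>#proots ?p. [:- x, 1:]) z))"
    using lcnz ln_norm_prod_linear_factors(2)[of "proots ?p" z] nz by (simp add: ln_mult)
  then show ?thesis using ln_norm_prod_linear_factors(1)[of "proots ?p" z] nz by (simp add: root_sum_def)
qed

lemma root_sum_add: "root_sum p (\<lambda>x. g x + h x) \<zeta> = root_sum p g \<zeta> + root_sum p h \<zeta>"
  by (simp add: root_sum_def sum_mset.distrib)

lemma root_sum_mult: "root_sum p (\<lambda>x. s * h x) \<zeta> = s * root_sum p h (\<zeta>::complex)" for s :: "'a::semiring_0"
  by (simp add: root_sum_def sum_mset_distrib_left)

lemma root_sum_of_real: "root_sum p (\<lambda>x. complex_of_real (h x)) \<zeta> = of_real (root_sum p h \<zeta>)"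
proof -
  have "(\<Sum>x\<in>#M. complex_of_real (h x)) = of_real (\<Sum>x\<in>#M. h x)" for M by (induction M) auto
  then show ?thesis by (simp add: root_sum_def)
qed

lemma root_sum_Re: "root_sum p (\<lambda>x. Re (h x)) \<zeta> = Re (root_sum p h \<zeta>)"
proof -
  have "(\<Sum>x\<in>#M. Re (h x)) = Re (\<Sum>x\<in>#M. h x)" for M by (induction M) auto
  then show ?thesis by (simp add: root_sum_def)
qed

lemma root_sum_norm_le:
  fixes h :: "complex \<Rightarrow> 'a::real_normed_vector"
  assumes "\<And>x. poly p x = \<zeta> \<Longrightarrow> norm (h x) \<le> B" "degree p > 0"
  shows "norm (root_sum p h \<zeta>) \<le> real (degree p) * B"
proof -
  have nz: "p - [:\<zeta>:] \<noteq> 0" using assms(2) degree_diff_const[of p \<zeta>] by auto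
  have *: "norm (\<Sum>x\<in>#M. h x) \<le> real (size M) * B" if "\<And>x. x \<in># M \<Longrightarrow> norm (h x) \<le> B" for M
    using that
  proof (induction M)
    case (add a M)
    then have "norm (h a) \<le> B" "norm (\<Sum>x\<in>#M. h x) \<le> real (size M) * B" by auto
    then show ?case using norm_triangle_ineq[of "h a" "\<Sum>x\<in>#M. h x"] by (simp add: algebra_simps)
  qed simp
  have "norm (root_sum p h \<zeta>) \<le> real (size (proots (p - [:\<zeta>:]))) * B"
    unfolding root_sum_def by (rule *) (use assms(1) nz in auto)
  then show ?thesis by (simp add: size_proots_complex degree_diff_const)
qed

section \<open>The balanced property of the harmonic measure\<close>

context julia_harmonic
begin

lemma f_deg_pos: "d > 0" using deg by linarith

lemma indicator_times_cont_measurable: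
  fixes h :: "complex \<Rightarrow> 'a::real_normed_vector"
  shows "continuous_on J h \<Longrightarrow> (\<lambda>w. indicat_real J w *\<^sub>R h w) \<in> borel_measurable borel"
  using borel_measurable_continuous_on_indicator[OF julia_sets, of h] by simp

lemma
  fixes h :: "complex \<Rightarrow> 'a::{banach, second_countable_topology}"
  assumes h: "continuous_on J h"
  shows set_integrable_julia: "set_integrable \<omega> J h"
    and norm_set_integral_julia_le: "(\<And>w. w \<in> J \<Longrightarrow> norm (h w) \<le> B) \<Longrightarrow> norm (LINT w:J|\<omega>. h w) \<le> B"
proof -
  obtain C where C: "\<And>w. w \<in> J \<Longrightarrow> norm (h w) \<le> C"
    using compact_imp_bounded[OF compact_continuous_image[OF h compact_filled_julia]] unfolding bounded_iff by blast
  show "set_integrable \<omega> J h" unfolding set_integrable_def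
    by (rule integrable_omega[OF indicator_times_cont_measurable[OF h], of C]) (use C in auto)
  show "norm (LINT w:J|\<omega>. h w) \<le> B" if "\<And>w. w \<in> J \<Longrightarrow> norm (h w) \<le> B"
    unfolding set_lebesgue_integral_def
    by (rule norm_integral_omega_le[OF indicator_times_cont_measurable[OF h]]) (use that in auto)
qed

lemma continuous_on_root_sum_julia:
  fixes h :: "complex \<Rightarrow> 'a::real_normed_vector"
  shows "continuous_on J h \<Longrightarrow> continuous_on J (root_sum f h)"
  by (rule continuous_on_root_sum[OF f_deg_pos compact_filled_julia]) (auto simp: poly_in_filled_julia_iff)

text \<open>
  Vanishing of \<open>balance\<close> on a function expresses that \<open>\<omega>\<close> is balanced: it assigns the same
  integral to the function as \<open>1 / d\<close> times the pullback of \<open>\<omega>\<close> under \<open>f\<close> does.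
\<close>

definition balance :: "(complex \<Rightarrow> complex) \<Rightarrow> complex" where
  "balance h = of_nat d * (LINT w:J|\<omega>. h w) - (LINT w:J|\<omega>. root_sum f h w)"

text \<open>Each term contributes \<open>d\<close> to the bound: the factor of the first integral,
  and the \<open>d\<close> points of a fibre in the second.\<close>

sublocale balance: bounded_C_functional J balance "2 * real d"
proof
  fix g h :: "complex \<Rightarrow> complex" and s :: complex and B :: real
  assume h: "continuous_on J h"
  note ih = set_integrable_julia[OF h] set_integrable_julia[OF continuous_on_root_sum_julia[OF h]]
  show "balance (\<lambda>w. s * h w) = s * balance h"
    using ih by (simp add: balance_def root_sum_mult algebra_simps)
  {
    assume g: "continuous_on J g"
    note ig = set_integrable_julia[OF g] set_integrable_julia[OF continuous_on_root_sum_julia[OF g]]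
    show "balance (\<lambda>w. g w + h w) = balance g + balance h"
      using ih ig by (simp add: balance_def root_sum_add set_integral_add algebra_simps)
  }
  assume B: "0 \<le> B" "\<And>w. w \<in> J \<Longrightarrow> norm (h w) \<le> B"
  have "norm (balance h) \<le> norm (of_nat d * (LINT w:J|\<omega>. h w)) + norm (LINT w:J|\<omega>. root_sum f h w)"
    unfolding balance_def by (rule norm_triangle_ineq4)
  also have "norm (of_nat d * (LINT w:J|\<omega>. h w)) \<le> d * B"
    unfolding norm_mult using norm_set_integral_julia_le[OF h B(2)] by (simp add: mult_left_mono)
  also have "norm (LINT w:J|\<omega>. root_sum f h w) \<le> d * B"
  proof (rule norm_set_integral_julia_le[OF continuous_on_root_sum_julia[OF h]])
    fix \<zeta> assume \<zeta>: "\<zeta> \<in> J"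
    show "norm (root_sum f h \<zeta>) \<le> d * B"
    proof (rule root_sum_norm_le[OF B(2) f_deg_pos])
      show "x \<in> J" if "poly f x = \<zeta>" for x using poly_in_filled_julia_iff[of x] \<zeta> that by simp
    qed
  qed
  finally show "norm (balance h) \<le> 2 * real d * B" by (simp add: mult_ac)
qed (rule compact_filled_julia)

lemma balance_of_real:
  "balance (\<lambda>w. of_real (h w)) = of_real (d * (LINT w:J|\<omega>. h w) - (LINT w:J|\<omega>. root_sum f h w))"
proof -
  have "(LINT w:J|\<omega>. complex_of_real (k w)) = of_real (LINT w:J|\<omega>. k w)" for k
    unfolding set_lebesgue_integral_def by (simp add: scaleR_conv_of_real flip: integral_complex_of_real)
  then show ?thesis by (simp add: balance_def root_sum_of_real)
qed

lemma set_integral_julia_eq: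
  fixes g :: "complex \<Rightarrow> real"
  assumes [measurable]: "g \<in> borel_measurable borel"
  shows "(LINT w:J|\<omega>. g w) = (\<integral>w. g w \<partial>\<omega>)"
  unfolding set_lebesgue_integral_def
proof (rule integral_cong_AE)
  show "AE w in \<omega>. indicat_real J w *\<^sub>R g w = g w" using AE_julia by eventually_elim simp
qed measurable

lemma balance_ln:
  assumes z: "norm z > R"
  shows "balance (\<lambda>w. of_real (ln (norm (z - w)))) = 0"
proof -
  have zJ: "z \<notin> J" using norm_le_filled_julia[of z] z by auto
  then have fJ: "poly f z \<notin> J" by (simp add: poly_in_filled_julia_iff)
  have "(LINT \<zeta>:J|\<omega>. root_sum f (\<lambda>w. ln (norm (z - w))) \<zeta>)
      = (LINT \<zeta>:J|\<omega>. ln (norm (poly f z - \<zeta>)) - ln (norm (lead_coeff f)))"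
    by (rule set_lebesgue_integral_cong) (use fJ in \<open>auto intro!: root_sum_ln_norm f_deg_pos\<close>)
  also have "\<dots> = (\<integral>\<zeta>. ln (norm (poly f z - \<zeta>)) - ln (norm (lead_coeff f)) \<partial>\<omega>)"
    by (rule set_integral_julia_eq) measurable
  also have "\<dots> = potential (poly f z) - ln (norm (lead_coeff f))"
  proof -
    obtain B where B: "\<And>y w. y \<in> {poly f z} \<Longrightarrow> w \<in> J \<Longrightarrow> \<bar>ln (norm (y - w))\<bar> \<le> B"
      using kernel_bound[of "{poly f z}"] fJ by auto
    have "integrable \<omega> (\<lambda>w. ln (norm (poly f z - w)))" by (rule integrable_omega[of _ B]) (use B in auto)
    then show ?thesis by (simp add: potential_def)
  qed
  also have "\<dots> = d * potential z" using potential_functional_eq[OF z] by simp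
  also have "potential z = (LINT w:J|\<omega>. ln (norm (z - w)))"
    unfolding potential_def by (rule set_integral_julia_eq[symmetric]) measurable
  finally show ?thesis by (simp add: balance_of_real)
qed

lemma balance_kernel: "z \<notin> J \<Longrightarrow> balance (\<lambda>w. 1 / (z - w)) = 0"
proof (rule balance.kernel_functional_eq_0[OF connected_compl_filled_julia])
  show "open (- cball (0::complex) R)" by auto
  have "of_real (R + 1) \<in> - cball (0::complex) R" using R1 by (simp del: of_real_add)
  then show "- cball (0::complex) R \<noteq> {}" by blast
  show "- cball 0 R \<subseteq> - J" using norm_le_filled_julia by auto
  show "balance (\<lambda>w. of_real (Re (h w))) = of_real (Re (balance h))" if h: "continuous_on J h" for h
  proof -
    have Re: "(LINT w:J|\<omega>. Re (k w)) = Re (LINT w:J|\<omega>. k w)" if "continuous_on J k" for k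
      using integral_Re[OF set_integrable_julia[OF that, unfolded set_integrable_def]]
      by (simp add: set_lebesgue_integral_def)
    have "root_sum f (\<lambda>w. Re (h w)) = (\<lambda>\<zeta>. Re (root_sum f h \<zeta>))" by (rule ext) (rule root_sum_Re)
    then show ?thesis unfolding balance_of_real
      using Re[OF h] Re[OF continuous_on_root_sum_julia[OF h]] by (simp add: balance_def)
  qed
  show "balance (\<lambda>w. of_real (ln (norm (z - w)))) = 0" if "z \<in> - cball 0 R" for z
    using that by (intro balance_ln) auto
qed

section \<open>Preimage counts of clopen sets and components\<close>

definition root_count :: "complex set \<Rightarrow> complex \<Rightarrow> real" where
  "root_count E = root_sum f (indicat_real E)"

lemma root_count_le:
  assumes "\<zeta> \<in> J"
  shows "0 \<le> root_count E \<zeta>" "root_count E \<zeta> \<le> d"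
proof -
  have "0 \<le> (\<Sum>x\<in>#M. indicat_real E x)" for M by (induction M) auto
  then show "0 \<le> root_count E \<zeta>" by (simp add: root_count_def root_sum_def)
  have "norm (root_count E \<zeta>) \<le> real d * 1" unfolding root_count_def by (intro root_sum_norm_le f_deg_pos) auto
  then show "root_count E \<zeta> \<le> d" by simp
qed

lemma root_count_eq_0: "(\<And>x. poly f x = \<zeta> \<Longrightarrow> x \<notin> E) \<Longrightarrow> root_count E \<zeta> = 0"
  using root_sum_norm_le[of f \<zeta> "indicat_real E" 0] f_deg_pos by (simp add: root_count_def)

lemma root_count_le_missing:
  assumes "poly f y = \<zeta>" "y \<notin> E"
  shows "root_count E \<zeta> \<le> d - 1"
proof -
  have nz: "f - [:\<zeta>:] \<noteq> 0" using f_deg_pos degree_diff_const[of f \<zeta>] by auto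
  have "y \<in># proots (f - [:\<zeta>:])" using assms nz by simp
  then obtain M where M: "proots (f - [:\<zeta>:]) = add_mset y M" by (metis multi_member_split)
  have "Suc (size M) = d" using size_proots_complex[of "f - [:\<zeta>:]"] by (simp add: M degree_diff_const)
  moreover have "(\<Sum>x\<in>#N. indicat_real E x) \<le> size N" for N
    by (induction N) (auto simp: indicator_def)
  from this[of M] have "root_count E \<zeta> \<le> size M" using assms(2) by (simp add: root_count_def root_sum_def M)
  ultimately show ?thesis by linarith
qed

lemma continuous_on_indicator_clopen:
  assumes "closed E" "closed F" "E \<inter> F = {}" "E \<union> F = J"
  shows "continuous_on J (indicat_real E)"
  using continuous_on_extend_0_disjoint[OF assms(1-3), of "\<lambda>_. 1::real"] assms(4)
  by (simp add: indicator_def[abs_def] of_bool_def)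

lemma clopen_balance:
  assumes E: "closed E" "closed F" "E \<inter> F = {}" "E \<union> F = J"
  shows "d * measure \<omega> E = (LINT \<zeta>:J|\<omega>. root_count E \<zeta>)"
proof -
  have [measurable]: "E \<in> sets borel" using E(1) by simp
  have "balance (\<lambda>w. of_real (indicat_real E w)) = 0"
  proof -
    have "(\<lambda>w. complex_of_real (indicat_real E w)) = (\<lambda>w. if w \<in> E then 1 else 0)" by (auto simp: indicator_def)
    then show ?thesis using balance.indicator_functional_eq_0[OF E balance_kernel] by simp
  qed
  then have "d * (LINT w:J|\<omega>. indicat_real E w) = (LINT w:J|\<omega>. root_sum f (indicat_real E) w)"
    unfolding balance_of_real of_real_eq_0_iff by simp
  moreover have "(LINT w:J|\<omega>. indicat_real E w) = measure \<omega> E"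
    by (subst set_integral_julia_eq) auto
  ultimately show ?thesis by (simp add: root_count_def)
qed

text \<open>Components of a compact set have arbitrarily small relatively clopen neighbourhoods. The
  sets need not decrease: that each point off \<open>K\<close> is eventually excluded suffices for
  pointwise convergence of the indicators.\<close>

lemma component_clopen_sequence:
  assumes K: "K \<in> components J"
  obtains E where "\<And>n. closed (E n)" "\<And>n. closed (J - E n)" "\<And>n. E n \<subseteq> J" "\<And>n. K \<subseteq> E n"
    "\<And>x. x \<notin> K \<Longrightarrow> \<forall>\<^sub>F n in sequentially. x \<notin> E n"
proof -
  have cK: "compact K" by (rule compact_components[OF compact_filled_julia K])
  have ne: "K \<noteq> {}" by (rule in_components_nonempty[OF K])
  have ex: "\<exists>E. openin (top_of_set J) E \<and> compact E \<and> K \<subseteq> E \<and> E \<subseteq> {z. infdist z K < 1 / Suc n}" for n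
  proof -
    have "open {z. infdist z K < 1 / Suc n}" by (intro open_Collect_less continuous_intros)
    then show ?thesis
      by (rule Sura_Bura_clopen_subset[OF closed_imp_locally_compact[OF closed_filled_julia] K cK]) auto
  qed
  then obtain E where E: "\<And>n. openin (top_of_set J) (E n)" "\<And>n. compact (E n)" "\<And>n. K \<subseteq> E n"
    "\<And>n. E n \<subseteq> {z. infdist z K < 1 / Suc n}" by metis
  show ?thesis
  proof (rule that[of E])
    show "closed (E n)" for n using E(2) by (rule compact_imp_closed)
    show "E n \<subseteq> J" for n using E(1) openin_imp_subset by blast
    show "closed (J - E n)" for n
    proof -
      obtain W where "open W" "E n = J \<inter> W" using E(1)[of n] unfolding openin_open by metis
      then show ?thesis using closed_Diff[OF closed_filled_julia, of W] by (simp add: Diff_Int)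
    qed
    show "K \<subseteq> E n" for n by (rule E(3))
    fix x assume "x \<notin> K"
    then have "infdist x K > 0"
      using in_closed_iff_infdist_zero[OF compact_imp_closed[OF cK] ne, of x] infdist_nonneg[of x K] by linarith
    then have "\<forall>\<^sub>F n in sequentially. 1 / Suc n < infdist x K"
      using order_tendstoD(2)[OF LIMSEQ_Suc[OF lim_1_over_n]] by simp
    then show "\<forall>\<^sub>F n in sequentially. x \<notin> E n"
      by eventually_elim (use E(4) in force)
  qed
qed

text \<open>Fibres are finite, so the count for \<open>E n\<close> over a fixed point eventually
  equals that for \<open>K\<close>. Dominated convergence with bound \<open>d\<close> passes to the
  limit, and the count for \<open>K\<close> is measurable on \<open>J\<close> as a limit.\<close>

lemma component_balance:
  assumes K: "K \<in> components J"
  shows "d * measure \<omega> K = (LINT \<zeta>:J|\<omega>. root_count K \<zeta>)" and "set_integrable \<omega> J (root_count K)"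
proof -
  obtain E where E: "\<And>n. closed (E n)" "\<And>n. closed (J - E n)" "\<And>n. E n \<subseteq> J" "\<And>n. K \<subseteq> E n"
    "\<And>x. x \<notin> K \<Longrightarrow> \<forall>\<^sub>F n in sequentially. x \<notin> E n"
    using component_clopen_sequence[OF K] by blast
  have [measurable]: "K \<in> sets borel" "E n \<in> sets borel" for n
    using compact_components[OF compact_filled_julia K] E(1) by (auto intro: borel_compact)
  have ev: "\<forall>\<^sub>F n in sequentially. indicat_real (E n) x = indicat_real K x" for x
  proof (cases "x \<in> K")
    case True
    then show ?thesis using E(4) by (simp add: indicator_def subset_iff)
  next
    case False
    from E(5)[OF this] show ?thesis by eventually_elim (use False in auto)
  qed
  have evs: "\<forall>\<^sub>F n in sequentially. (\<Sum>x\<in>#M. indicat_real (E n) x) = (\<Sum>x\<in>#M. indicat_real K x)" for M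
  proof (induction M)
    case (add a M)
    from this ev[of a] show ?case by eventually_elim simp
  qed simp
  let ?g = "\<lambda>n \<zeta>. indicat_real J \<zeta> *\<^sub>R root_count (E n) \<zeta>"
  let ?h = "\<lambda>\<zeta>. indicat_real J \<zeta> *\<^sub>R root_count K \<zeta>"
  have gm: "?g n \<in> borel_measurable \<omega>" for n
  proof -
    have "E n \<inter> (J - E n) = {}" "E n \<union> (J - E n) = J" using E(3) by auto
    from indicator_times_cont_measurable[OF continuous_on_root_sum_julia[OF continuous_on_indicator_clopen[OF E(1,2) this]]]
    show ?thesis by (simp add: root_count_def)
  qed
  have lim: "(\<lambda>n. ?g n \<zeta>) \<longlonglongrightarrow> ?h \<zeta>" for \<zeta>
    using evs[of "proots (f - [:\<zeta>:])"]
    by (intro tendsto_eventually) (auto simp: root_count_def root_sum_def elim: eventually_mono)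
  have hmeas: "?h \<in> borel_measurable \<omega>" using borel_measurable_LIMSEQ_metric[OF gm lim] .
  have bnd: "norm (?g n \<zeta>) \<le> d" for n \<zeta>
    using root_count_le[of \<zeta> "E n"] by (auto simp: indicator_def)
  have "(\<lambda>n. \<integral>\<zeta>. ?g n \<zeta> \<partial>\<omega>) \<longlonglongrightarrow> (\<integral>\<zeta>. ?h \<zeta> \<partial>\<omega>)"
    by (rule integral_dominated_convergence[where w = "\<lambda>_. real d"]) (use hmeas gm lim bnd in auto)
  moreover have "(\<integral>\<zeta>. ?g n \<zeta> \<partial>\<omega>) = d * measure \<omega> (E n)" for n
    using clopen_balance[OF E(1,2)[of n]] E(3)[of n] by (simp add: set_lebesgue_integral_def Un_absorb1)
  moreover have "(\<lambda>n. d * (\<integral>x. indicat_real (E n) x \<partial>\<omega>)) \<longlonglongrightarrow> d * (\<integral>x. indicat_real K x \<partial>\<omega>)"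
    by (intro tendsto_mult tendsto_const integral_dominated_convergence[where w = "\<lambda>_. 1"])
      (use ev in \<open>auto intro!: AE_I2 tendsto_eventually\<close>)
  ultimately show "d * measure \<omega> K = (LINT \<zeta>:J|\<omega>. root_count K \<zeta>)"
    unfolding set_lebesgue_integral_def by (simp add: LIMSEQ_unique)
  show "set_integrable \<omega> J (root_count K)"
    unfolding set_integrable_def
    by (rule integrable_const_bound[OF _ hmeas, of d]) (use root_count_le[of _ K] in \<open>auto simp: indicator_def\<close>)
qed

text \<open>Points of \<open>K\<close> lie only over \<open>K'\<close>, so the count is at most
  \<open>d\<close> times the indicator of \<open>K'\<close>. A point \<open>y\<close> over
  \<open>K'\<close> but outside \<open>K\<close> costs a root in every fibre over \<open>K'\<close>:
  the component of the preimage through \<open>y\<close> is disjoint from \<open>K\<close> and maps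
  onto \<open>K'\<close>.\<close>

lemma component_measure_le:
  assumes K: "K \<in> components J" and K': "K' \<in> components J" and sub: "poly f ` K \<subseteq> K'"
  shows "measure \<omega> K \<le> measure \<omega> K'"
    and "poly f y \<in> K' \<Longrightarrow> y \<notin> K \<Longrightarrow> d * measure \<omega> K \<le> (d - 1) * measure \<omega> K'"
proof -
  have [measurable]: "K' \<in> sets borel"
    using compact_components[OF compact_filled_julia K'] by (rule borel_compact)
  have KJ: "K \<subseteq> J" "K' \<subseteq> J" using in_components_subset K K' by auto
  have main: "d * measure \<omega> K \<le> b * measure \<omega> K'" if b: "\<And>\<zeta>. \<zeta> \<in> K' \<Longrightarrow> root_count K \<zeta> \<le> b" for b
  proof -
    have "d * measure \<omega> K = (LINT \<zeta>:J|\<omega>. root_count K \<zeta>)" by (rule component_balance(1)[OF K])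
    also have "\<dots> \<le> (\<integral>\<zeta>. b * indicat_real K' \<zeta> \<partial>\<omega>)"
      unfolding set_lebesgue_integral_def
    proof (rule integral_mono)
      show "integrable \<omega> (\<lambda>\<zeta>. indicat_real J \<zeta> *\<^sub>R root_count K \<zeta>)"
        using component_balance(2)[OF K] by (simp add: set_integrable_def)
      show "integrable \<omega> (\<lambda>\<zeta>. b * indicat_real K' \<zeta>)"
        by (rule integrable_omega[of _ "\<bar>b\<bar>"]) (auto simp: indicator_def)
      fix \<zeta>
      show "indicat_real J \<zeta> *\<^sub>R root_count K \<zeta> \<le> b * indicat_real K' \<zeta>"
      proof (cases "\<zeta> \<in> K'")
        case True
        then show ?thesis using b KJ(2) by auto
      next
        case False
        then have "root_count K \<zeta> = 0" using sub by (intro root_count_eq_0) auto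
        then show ?thesis using False by simp
      qed
    qed
    also have "\<dots> = b * measure \<omega> K'" by simp
    finally show ?thesis .
  qed
  have "d * measure \<omega> K \<le> d * measure \<omega> K'" using root_count_le(2) KJ(2) by (intro main) auto
  then show "measure \<omega> K \<le> measure \<omega> K'" using f_deg_pos by simp
  assume y: "poly f y \<in> K'" "y \<notin> K"
  have cpt: "compact (poly f -` K')"
  proof -
    have "poly f -` K' \<subseteq> J" using KJ(2) poly_in_filled_julia_iff by auto
    moreover have "closed (poly f -` K')"
      by (intro closed_vimage compact_imp_closed compact_components[OF compact_filled_julia K'] continuous_intros)
    ultimately show ?thesis
      using compact_filled_julia by (meson bounded_subset compact_eq_bounded_closed)
  qed
  define A where "A = connected_component_set (poly f -` K') y"
  have A: "A \<in> components (poly f -` K')" and yA: "y \<in> A"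
    using y(1) by (auto simp: A_def componentsI connected_component_refl)
  have AJ: "A \<subseteq> J" using in_components_subset[OF A] KJ(2) poly_in_filled_julia_iff by auto
  have "A \<inter> K = {}"
  proof (rule ccontr)
    assume "A \<inter> K \<noteq> {}"
    then have "A \<subseteq> K" using components_maximal[OF K in_components_connected[OF A] AJ] by (simp add: Int_commute)
    then show False using yA y(2) by auto
  qed
  moreover have "poly f ` A = K'"
    by (rule poly_component_surj[OF f_deg_pos in_components_connected[OF K'] cpt A])
  ultimately have "\<exists>x. poly f x = \<zeta> \<and> x \<notin> K" if "\<zeta> \<in> K'" for \<zeta> using that by blast
  then show "d * measure \<omega> K \<le> (d - 1) * measure \<omega> K'"
    using root_count_le_missing f_deg_pos by (intro order_trans[OF main[of "real d - 1"]]) (auto simp: of_nat_diff)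
qed

lemma component_null:
  assumes disc: "\<not> connected J" and K: "K \<in> components J"
  shows "measure \<omega> K = 0"
proof (rule ccontr)
  assume nz: "measure \<omega> K \<noteq> 0"
  have ex: "\<exists>K'. K' \<in> components J \<and> poly f ` K \<subseteq> K'" if K: "K \<in> components J" for K
  proof -
    have "connected (poly f ` K)"
      by (intro connected_continuous_image continuous_intros in_components_connected[OF K])
    moreover have "poly f ` K \<subseteq> J" using in_components_subset[OF K] poly_in_filled_julia_iff by auto
    moreover have "poly f ` K \<noteq> {}" using in_components_nonempty[OF K] by simp
    ultimately show ?thesis by (metis exists_component_superset subset_empty)
  qed
  then obtain nx where nx: "\<And>K. K \<in> components J \<Longrightarrow> nx K \<in> components J \<and> poly f ` K \<subseteq> nx K" by metis
  define Q where "Q n = (nx ^^ n) K" for n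
  have Q: "Q n \<in> components J" for n by (induction n) (auto simp: Q_def K nx)
  have Qs: "poly f ` Q n \<subseteq> Q (Suc n)" for n using nx[OF Q[of n]] by (simp add: Q_def)
  have QJ: "Q n \<subseteq> J" for n using Q in_components_subset by blast
  have mono: "measure \<omega> (Q m) \<le> measure \<omega> (Q n)" if "m \<le> n" for m n
    using component_measure_le(1)[OF Q Q Qs] that by (rule lift_Suc_mono_le)
  have pos: "measure \<omega> (Q n) > 0" for n
    using mono[of 0 n] nz zero_less_measure_iff[of \<omega> K] by (simp add: Q_def)
  \<comment> \<open>Distinct components are disjoint, so infinitely many of them would have summable
    masses, although each mass is at least that of \<open>K\<close>.\<close>
  have "\<not> inj Q"
  proof
    assume inj: "inj Q"
    have dis: "disjoint_family Q"
      unfolding disjoint_family_on_def using components_nonoverlap[OF Q Q] inj by (simp add: inj_eq)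
    have "range Q \<subseteq> sets \<omega>"
      unfolding sets_omega using compact_components[OF compact_filled_julia Q] by (auto intro: borel_compact)
    from finite_measure_UNION[OF this dis] have "summable (\<lambda>n. measure \<omega> (Q n))" by (rule sums_summable)
    then have "(\<lambda>n. measure \<omega> (Q n)) \<longlonglongrightarrow> 0" by (rule summable_LIMSEQ_zero)
    then have "measure \<omega> (Q 0) \<le> 0" using mono[of 0] by (intro LIMSEQ_le_const) auto
    then show False using pos[of 0] by simp
  qed
  then obtain m' n' where "Q m' = Q n'" "m' \<noteq> n'" unfolding inj_def by blast
  then obtain m k where mk: "Q m = Q (m + k)" "k > 0"
    by (metis less_imp_add_positive linorder_neqE_nat)
  \<comment> \<open>Along the cycle the nondecreasing masses return to their initial value, so they
    are equal; a preimage outside \<open>Q n\<close> would give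
    \<open>d * x \<le> (d - 1) * x\<close> for a positive mass \<open>x\<close>.\<close>
  have preimage: "poly f -` Q (Suc n) = Q n" if n: "m \<le> n" "n < m + k" for n
  proof
    show "Q n \<subseteq> poly f -` Q (Suc n)" using Qs by auto
    show "poly f -` Q (Suc n) \<subseteq> Q n"
    proof (rule ccontr)
      assume "\<not> ?thesis"
      then obtain y where y: "poly f y \<in> Q (Suc n)" "y \<notin> Q n" by auto
      have "d * measure \<omega> (Q n) \<le> (d - 1) * measure \<omega> (Q (Suc n))"
        by (rule component_measure_le(2)[OF Q Q Qs y])
      also have "measure \<omega> (Q (Suc n)) \<le> measure \<omega> (Q n)"
        using mono[of "Suc n" "m + k"] mono[of m n] mk(1) n by simp
      finally have "d * measure \<omega> (Q n) \<le> (d - 1) * measure \<omega> (Q n)" by (simp add: mult_left_mono)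
      then show False using pos[of n] f_deg_pos by simp
    qed
  qed
  have "poly (iter j) -` Q (m + j) = Q m" if "j \<le> k" for j
    using that
  proof (induction j)
    case (Suc j)
    have "poly (iter (Suc j)) -` Q (m + Suc j) = poly (iter j) -` (poly f -` Q (Suc (m + j)))"
      by (auto simp: poly_iter_Suc)
    also have "\<dots> = Q m" using preimage[of "m + j"] Suc by simp
    finally show ?case .
  qed auto
  from this[of k] have "poly (iter k) -` Q m = Q m" using mk(1) by simp
  then have "connected J"
    using in_components_connected[OF Q] in_components_nonempty[OF Q] QJ mk(2) by (intro connected_filled_julia) auto
  then show False using disc by simp
qed

end

theorem corollary3p5:
  fixes f :: "complex poly" and \<omega> :: "complex measure" and K :: "complex set"
  assumes "degree f \<ge> 2"
    and "\<not> connected (julia f)"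
    and "is_harmonic_measure (filled_julia f) \<omega>"
    and "K \<in> components (filled_julia f)"
  shows "emeasure \<omega> K = 0"
proof -
  obtain R c\<^sub>0 where "escaping_poly f R c\<^sub>0" using escaping_poly_exists[OF assms(1)] by blast
  then interpret julia_harmonic f R c\<^sub>0 \<omega>
    using assms(3) by (simp add: julia_harmonic_def julia_harmonic_axioms_def)
  \<comment> \<open>A connected set with connected complement has connected frontier, so
    disconnectedness passes from the Julia set to the filled Julia set.\<close>
  have "\<not> connected (filled_julia f)"
    using assms(2) connected_frontier_simple[OF _ connected_compl_filled_julia] unfolding julia_def by blast
  from component_null[OF this assms(4)] show ?thesis by (simp add: emeasure_eq_measure)
qed

end
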